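(* Let $\alpha>-1$ and $\beta>-1$ be real and let $M,N$ be positive integers. Then, as $n\to\infty$, $$\sum_{k=1}^{n-1} k^\beta (n-k)^\alpha=\frac{\Gamma(\alpha+1)\Gamma(\beta+1)}{\Gamma(\alpha+\beta+2)}n^{\alpha+\beta+1}+\sum_{k=0}^{M-1} (-1)^k\binom{\beta}{k}\zeta(-\alpha-k)\,n^{\beta-k}+\sum_{k=0}^{N-1} (-1)^k\binom{\alpha}{k}\zeta(-\beta-k)\,n^{\alpha-k}+O\left( n^{\max\{\beta-M,\alpha-N\} } \right).$$
   Context: $\zeta$ is the Riemann zeta function (analytically continued), and $\binom{\gamma}{k}=\frac{\gamma(\gamma-1)\cdots(\gamma-k+1)}{k!}$ is the generalized binomial coefficient. *)

theory Defs
  imports "HOL-Complex_Analysis.Complex_Analysis" "HOL-Library.Landau_Symbols"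
begin

(* On -{1} such a function exists (analytic continuation) and is unique (identity theorem),
   so SOME pins down every value except the one at the pole 1, which is unspecified. *)
definition riemann_zeta :: "complex \<Rightarrow> complex" where
  "riemann_zeta = (SOME f. f holomorphic_on (- {1}) \<and>
     (\<forall>s. Re s > 1 \<longrightarrow> (\<lambda>n. 1 / of_nat (Suc n) powr s) sums f s))"

end

theory Submission
  imports Defs
begin

text \<open>
  Put \<open>D\<close> for the left-hand sum minus its expansion with \<open>M\<close> and \<open>N\<close> terms. Writing \<open>n = k + (n - k)\<close> and
  using Pascal's rule gives the exact identity
  \<open>n * D(\<alpha>,\<beta>,M,N) = D(\<alpha>,\<beta>+1,M,N-1) + D(\<alpha>+1,\<beta>,M-1,N)\<close>, which is compatible with the claimed error term.
  Iterating it reduces the theorem to the case where \<open>\<alpha>\<close> is at least 2 and the error term swallows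
  everything that comes from the end \<open>k = n\<close>.

  In that case, write \<open>\<alpha> = q + r\<close> with \<open>r\<close> a natural number and \<open>1 \<le> q < 2\<close>. The sum is then a fractional
  integral of order \<open>q\<close> of the Riesz sum of \<open>(t - k) ^ r * k powr \<beta>\<close> over \<open>k \<le> t\<close>. As \<open>r\<close> is an integer, the
  Riesz sum expands binomially into the sums of \<open>k powr (\<beta> + j)\<close>, to which Euler-Maclaurin summation
  applies; the boundary terms recombine into derivatives of \<open>(t - x) ^ r * x powr \<beta>\<close> at the integer
  part of \<open>t\<close>, and these are small. The same Euler-Maclaurin expansion provides the analytic continuation
  of \<open>\<zeta>\<close>, hence the values \<open>\<zeta>(-\<beta> - j)\<close>.
\<close>

section \<open>Euler-Maclaurin summation of powers and the zeta function\<close>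

declare sum.cong [fundef_cong]

text \<open>The numbers \<open>B\<^sub>i / i!\<close> with \<open>B\<^sub>1 = 1/2\<close>; the recursion says that their generating function times
  \<open>1 - exp (- z)\<close> is \<open>z\<close>.\<close>

fun em_coeff :: "nat \<Rightarrow> real" where
  "em_coeff q = (if q = 0 then 1
     else - (\<Sum>i<q. em_coeff i * (-1) ^ (q - i) / fact (Suc (q - i))))"

declare em_coeff.simps [simp del]

lemma em_coeff_0 [simp]: "em_coeff 0 = 1"
  by (simp add: em_coeff.simps)

lemma em_coeff_convolution:
  "(\<Sum>i\<le>k. em_coeff i * (-1) ^ (k - i) / fact (Suc (k - i))) = (if k = 0 then 1 else 0)"
proof (cases "k = 0")
  case False
  have "(\<Sum>i\<le>k. em_coeff i * (-1) ^ (k - i) / fact (Suc (k - i)))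
      = (\<Sum>i<k. em_coeff i * (-1) ^ (k - i) / fact (Suc (k - i))) + em_coeff k"
    by (simp add: lessThan_Suc_atMost [symmetric])
  with False show ?thesis
    by (subst (asm) (3) em_coeff.simps) simp
qed simp

definition falling :: "complex \<Rightarrow> nat \<Rightarrow> complex" where
  "falling c q = (\<Prod>i<q. c - of_nat i)"

text \<open>Index 0 is the antiderivative of \<open>\<lambda>z. z powr c\<close>, so that index \<open>p\<close> is its \<open>(p - 1)\<close>-th derivative. Throughout,
  \<open>c\<close> stands for \<open>- s\<close>.\<close>

fun power_deriv :: "complex \<Rightarrow> nat \<Rightarrow> complex \<Rightarrow> complex" where
  "power_deriv c 0 z = z powr (c + 1) / (c + 1)"
| "power_deriv c (Suc q) z = falling c q * z powr (c - of_nat q)"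

lemma has_field_derivative_power_deriv:
  assumes "c \<noteq> -1" "Re z > 0"
  shows "(power_deriv c p has_field_derivative power_deriv c (Suc p) z) (at z within S)"
proof -
  have z: "z \<notin> \<real>\<^sub>\<le>\<^sub>0" using assms complex_nonpos_Reals_iff by auto
  have c: "c + 1 \<noteq> 0" using assms by (auto simp: add_eq_0_iff2)
  show ?thesis
  proof (cases p)
    case 0
    have "((\<lambda>z. z powr (c + 1) / (c + 1)) has_field_derivative power_deriv c (Suc 0) z) (at z within S)"
      using z c by (auto intro!: derivative_eq_intros simp: falling_def)
    moreover have "power_deriv c 0 = (\<lambda>z. z powr (c + 1) / (c + 1))" by (rule ext) simp
    ultimately show ?thesis by (simp only: 0)
  next
    case (Suc q)
    have "((\<lambda>z. falling c q * z powr (c - of_nat q)) has_field_derivative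
            power_deriv c (Suc (Suc q)) z) (at z within S)"
      using z by (auto intro!: derivative_eq_intros simp: falling_def algebra_simps)
    moreover have "power_deriv c (Suc q) = (\<lambda>z. falling c q * z powr (c - of_nat q))" by (rule ext) simp
    ultimately show ?thesis by (simp only: Suc)
  qed
qed

text \<open>Each \<open>power_deriv c i\<close> is expanded at \<open>m\<close> by Taylor's formula
  around \<open>m + 1\<close>, up to the derivative of index \<open>M + 1\<close>. When terms of
  equal index are collected, \<open>em_coeff_convolution\<close> cancels all but index 1, which is
  \<open>(m + 1) powr c\<close>. The orders of expansion are staggered, so every remainder involves
  the same derivative of index \<open>M + 2\<close>; the bound on \<open>Re c\<close> makes its
  modulus nonincreasing along the segment.\<close>

lemma euler_maclaurin_step:
  assumes c: "c \<noteq> -1" "Re c \<le> real M + 1" and m: "m \<ge> 1"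
  shows "cmod (of_nat (Suc m) powr c -
           (\<Sum>i\<le>M. of_real (em_coeff i) * (power_deriv c i (of_nat (Suc m)) - power_deriv c i (of_nat m))))
         \<le> (\<Sum>i\<le>M. \<bar>em_coeff i\<bar>) * cmod (falling c (Suc M)) * real m powr (Re c - real M - 1)"
proof -
  define w z where "w = (of_nat (Suc m) :: complex)" and "z = (of_nat m :: complex)"
  define g where "g = power_deriv c"
  define S where "S = closed_segment z w"
  define B where "B = cmod (falling c (Suc M)) * real m powr (Re c - real M - 1)"
  define R where "R i = g i z - (\<Sum>j\<le>M + 1 - i. g (i + j) w * (z - w) ^ j / fact j)" for i
  have zw: "z - w = -1" by (simp add: z_def w_def)
  have S: "\<exists>y. x = of_real y \<and> real m \<le> y" if x: "x \<in> S" for x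
  proof -
    obtain u where u: "0 \<le> u" "x = (1 - u) *\<^sub>R z + u *\<^sub>R w" 
      using x by (auto simp: S_def closed_segment_def)
    have "x = of_real (real m + u)"
      using u by (simp add: z_def w_def scaleR_conv_of_real algebra_simps)
    with u show ?thesis by (intro exI[of _ "real m + u"]) auto
  qed
  have B: "cmod (g (Suc (Suc M)) x) \<le> B" if x: "x \<in> S" for x
  proof -
    obtain y where y: "x = of_real y" "real m \<le> y" using S[OF x] by blast
    have "cmod (x powr (c - of_nat (Suc M))) = y powr (Re c - real M - 1)"
      using y m by (simp add: norm_powr_real_powr algebra_simps)
    also have "\<dots> \<le> real m powr (Re c - real M - 1)"
      using y m c by (intro powr_mono2') auto
    finally show ?thesis
      by (simp add: g_def B_def norm_mult mult_left_mono del: of_nat_Suc)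
  qed
  have R: "cmod (R i) \<le> B" if i: "i \<le> M" for i
  proof -
    have "cmod (g (i + 0) z - (\<Sum>j\<le>M + 1 - i. g (i + j) w * (z - w) ^ j / fact j))
        \<le> B * cmod (z - w) ^ Suc (M + 1 - i) / fact (M + 1 - i)"
    proof (rule complex_Taylor [of S])
      fix j x assume x: "x \<in> S"
      obtain y where y: "x = of_real y" "real m \<le> y" using S[OF x] by blast
      show "(g (i + j) has_field_derivative g (i + Suc j) x) (at x within S)"
        using has_field_derivative_power_deriv[of c x "i + j" S] c y m by (simp add: g_def)
    next
      fix x assume "x \<in> S"
      from B[OF this] show "cmod (g (i + Suc (M + 1 - i)) x) \<le> B"
        using i by simp
    qed (auto simp: S_def)
    also have "\<dots> \<le> B"
    proof -
      have "0 \<le> B" by (simp add: B_def)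
      then have "B * 1 \<le> B * fact (M + 1 - i)" by (intro mult_left_mono fact_ge_1)
      then show ?thesis by (simp add: zw divide_le_eq)
    qed
    finally show ?thesis by (simp add: R_def)
  qed
  have "(\<Sum>i\<le>M. of_real (em_coeff i) * (\<Sum>j\<le>M - i. g (Suc (i + j)) w * (-1) ^ j / fact (Suc j)))
      = (\<Sum>i\<le>M. \<Sum>j\<le>M - i. of_real (em_coeff i) * g (Suc (i + j)) w * (-1) ^ j / fact (Suc j))"
    by (simp add: sum_distrib_left mult.assoc)
  also have "\<dots> = (\<Sum>(i,j)\<in>{(i,j). i + j \<le> M}. of_real (em_coeff i) * g (Suc (i + j)) w * (-1) ^ j / fact (Suc j))"
    by (subst sum.Sigma) (auto intro!: sum.cong)
  also have "\<dots> = (\<Sum>k\<le>M. \<Sum>i\<le>k. of_real (em_coeff i) * g (Suc (i + (k - i))) w * (-1) ^ (k - i) / fact (Suc (k - i)))"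
    by (rule sum.triangle_reindex_eq)
  also have "\<dots> = (\<Sum>k\<le>M. g (Suc k) w * of_real (\<Sum>i\<le>k. em_coeff i * (-1) ^ (k - i) / fact (Suc (k - i))))"
    by (auto intro!: sum.cong simp: sum_distrib_left)
  also have "\<dots> = (\<Sum>k\<le>M. if k = 0 then g (Suc k) w else 0)"
    unfolding em_coeff_convolution by (rule sum.cong) auto
  also have "\<dots> = g 1 w"
    by simp
  finally have main: "(\<Sum>i\<le>M. of_real (em_coeff i) * (\<Sum>j\<le>M - i. g (Suc (i + j)) w * (-1) ^ j / fact (Suc j))) = g 1 w" .
  have diff: "g i w - g i z = (\<Sum>j\<le>M - i. g (Suc (i + j)) w * (-1) ^ j / fact (Suc j)) - R i"
    if i: "i \<le> M" for i
  proof -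
    have "(\<Sum>j\<le>M + 1 - i. g (i + j) w * (z - w) ^ j / fact j)
        = g i w + (\<Sum>j\<le>M - i. g (i + Suc j) w * (z - w) ^ Suc j / fact (Suc j))"
    proof -
      have "M + 1 - i = Suc (M - i)" using i by simp
      then show ?thesis by (simp only: sum.atMost_Suc_shift) simp
    qed
    also have "(\<Sum>j\<le>M - i. g (i + Suc j) w * (z - w) ^ Suc j / fact (Suc j))
        = - (\<Sum>j\<le>M - i. g (Suc (i + j)) w * (-1) ^ j / fact (Suc j))"
      by (simp add: zw sum_negf [symmetric])
    finally show ?thesis by (simp add: R_def)
  qed
  have "of_nat (Suc m) powr c = g 1 w"
    by (simp add: g_def w_def falling_def del: of_nat_Suc)
  also have "g 1 w - (\<Sum>i\<le>M. of_real (em_coeff i) * (g i w - g i z))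
     = (\<Sum>i\<le>M. of_real (em_coeff i) * R i)"
    by (subst main [symmetric]) (simp add: diff right_diff_distrib sum_subtractf)
  finally have "cmod (of_nat (Suc m) powr c - (\<Sum>i\<le>M. of_real (em_coeff i) * (g i w - g i z)))
     \<le> (\<Sum>i\<le>M. cmod (of_real (em_coeff i) * R i))"
    by (simp add: norm_sum)
  also have "\<dots> \<le> (\<Sum>i\<le>M. \<bar>em_coeff i\<bar> * B)"
    by (intro sum_mono) (auto simp: norm_mult intro!: mult_left_mono R)
  finally show ?thesis
    by (simp add: g_def w_def z_def B_def sum_distrib_right mult.assoc)
qed

text \<open>Index 0 subtracts the integral, the higher indices the boundary corrections. For
  \<open>c \<noteq> -1\<close> and \<open>Re c < M - 1\<close> the limit in \<open>n\<close> turns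
  out to be zeta at \<open>- c\<close>.\<close>

definition em_sum :: "nat \<Rightarrow> complex \<Rightarrow> nat \<Rightarrow> complex" where
  "em_sum M c n = (\<Sum>k=1..n. of_nat k powr c) - (\<Sum>i\<le>M. of_real (em_coeff i) * power_deriv c i (of_nat n))"

definition em_const :: "nat \<Rightarrow> real" where
  "em_const M = (\<Sum>i\<le>M. \<bar>em_coeff i\<bar>)"

lemma em_sum_diff_bound:
  assumes c: "c \<noteq> -1" "Re c \<le> real M + 1" and m: "m \<ge> 1"
  shows "cmod (em_sum M c (Suc m) - em_sum M c m)
       \<le> em_const M * cmod (falling c (Suc M)) * real m powr (Re c - real M - 1)"
proof -
  have "em_sum M c (Suc m) - em_sum M c m = of_nat (Suc m) powr c -
           (\<Sum>i\<le>M. of_real (em_coeff i) * (power_deriv c i (of_nat (Suc m)) - power_deriv c i (of_nat m)))"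
    by (simp add: em_sum_def right_diff_distrib sum_subtractf del: of_nat_Suc)
  with euler_maclaurin_step[OF assms] show ?thesis by (simp add: em_const_def)
qed

lemma falling_holomorphic [holomorphic_intros]:
  "f holomorphic_on A \<Longrightarrow> (\<lambda>c. falling (f c) q) holomorphic_on A"
  unfolding falling_def by (intro holomorphic_intros)

lemma em_sum_holomorphic:
  assumes "n > 0"
  shows "(\<lambda>c. em_sum M c n) holomorphic_on - {-1}"
proof -
  have "(\<lambda>c. power_deriv c i (of_nat n)) holomorphic_on - {-1}" for i
  proof (cases i)
    case 0
    show ?thesis using assms unfolding 0 power_deriv.simps
      by (intro holomorphic_intros) (auto simp: add_eq_0_iff2)
  next
    case (Suc q)
    show ?thesis unfolding Suc power_deriv.simps
      by (intro holomorphic_intros)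
  qed
  then show ?thesis unfolding em_sum_def by (intro holomorphic_intros)
qed

lemma summable_inverse_Suc_squares: "summable (\<lambda>m. 1 / real (Suc m) ^ 2)"
  using inverse_power_summable[of 2, where 'a=real] by (subst summable_Suc_iff) (simp add: field_simps)

text \<open>The differences telescope, and \<open>m powr e\<close> is split into
  \<open>m powr (e + 2)\<close>, at most its value at \<open>n\<close>, and the summable
  \<open>m powr (-2)\<close>. This loses one power of \<open>n\<close> against the sharp tail, but
  the constant does not depend on \<open>e\<close>, which later gives locally uniform convergence in
  \<open>c\<close>.\<close>

lemma sum_diff_bound_tail:
  fixes f :: "nat \<Rightarrow> complex"
  assumes f: "\<And>m. m \<ge> 1 \<Longrightarrow> cmod (f (Suc m) - f m) \<le> C * real m powr e" and e: "e \<le> -2" and C: "C \<ge> 0"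
  assumes n: "n \<ge> 1"
  shows "\<exists>l. f \<longlonglongrightarrow> l \<and> cmod (l - f n) \<le> C * (\<Sum>m. 1 / real (Suc m) ^ 2) * real n powr (e + 2)"
proof -
  define S where "S = (\<Sum>m. 1 / real (Suc m) ^ 2)"
  have bd: "cmod (f (Suc (m + n)) - f (m + n)) \<le> C * real n powr (e + 2) * (1 / real (Suc m) ^ 2)" for m
  proof -
    have "real (m + n) powr e = real (m + n) powr (e + 2) * real (m + n) powr (-2)"
      by (simp add: powr_add [symmetric])
    also have "\<dots> \<le> real n powr (e + 2) * real (Suc m) powr (-2)"
      using n e by (intro mult_mono powr_mono2') auto
    also have "real (Suc m) powr (-2) = 1 / real (Suc m) ^ 2"
      by (simp add: powr_minus powr_numeral divide_inverse)
    finally have "C * real (m + n) powr e \<le> C * (real n powr (e + 2) * (1 / real (Suc m) ^ 2))"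
      using C by (rule mult_left_mono)
    with f[of "m + n"] n show ?thesis by (simp add: mult.assoc)
  qed
  have sm2: "summable (\<lambda>m. f (Suc (m + n)) - f (m + n))"
    by (rule summable_comparison_test'[OF summable_mult[OF summable_inverse_Suc_squares] bd])
  define l where "l = f n + (\<Sum>m. f (Suc (m + n)) - f (m + n))"
  have "(\<lambda>N. f n + (\<Sum>m<N. f (Suc (m + n)) - f (m + n))) \<longlonglongrightarrow> l"
    unfolding l_def by (intro tendsto_intros summable_LIMSEQ sm2)
  also have "(\<lambda>N. f n + (\<Sum>m<N. f (Suc (m + n)) - f (m + n))) = (\<lambda>N. f (N + n))"
    using sum_lessThan_telescope[of "\<lambda>m. f (m + n)"] by (auto simp: fun_eq_iff)
  finally have lim: "f \<longlonglongrightarrow> l" by (rule LIMSEQ_offset)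
  have "cmod (l - f n) \<le> (\<Sum>m. C * real n powr (e + 2) * (1 / real (Suc m) ^ 2))"
    unfolding l_def add_diff_cancel_left' by (rule norm_suminf_le[OF bd summable_mult[OF summable_inverse_Suc_squares]])
  also have "\<dots> = C * S * real n powr (e + 2)"
    unfolding S_def by (subst suminf_mult[OF summable_inverse_Suc_squares]) simp
  finally show ?thesis using lim unfolding S_def by blast
qed

section \<open>The Euler-Maclaurin limit as the analytic continuation of zeta\<close>

definition em_limit :: "nat \<Rightarrow> complex \<Rightarrow> complex" where
  "em_limit M c = lim (em_sum M c)"

lemma em_sum_converges:
  assumes c: "c \<noteq> -1" "Re c < real M - 1" and n: "n \<ge> 1"
  shows "em_sum M c \<longlonglongrightarrow> em_limit M c"
    and "cmod (em_limit M c - em_sum M c n)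
       \<le> em_const M * cmod (falling c (Suc M)) * (\<Sum>m. 1 / real (Suc m) ^ 2) * real n powr (Re c - real M + 1)"
proof -
  have "\<exists>l. em_sum M c \<longlonglongrightarrow> l \<and> cmod (l - em_sum M c n)
       \<le> em_const M * cmod (falling c (Suc M)) * (\<Sum>m. 1 / real (Suc m) ^ 2) * real n powr (Re c - real M - 1 + 2)"
    by (rule sum_diff_bound_tail[OF em_sum_diff_bound]) (use assms in \<open>auto simp: em_const_def intro!: mult_nonneg_nonneg sum_nonneg\<close>)
  then obtain l where l: "em_sum M c \<longlonglongrightarrow> l" "cmod (l - em_sum M c n)
       \<le> em_const M * cmod (falling c (Suc M)) * (\<Sum>m. 1 / real (Suc m) ^ 2) * real n powr (Re c - real M - 1 + 2)"
    by blast
  have "em_limit M c = l" unfolding em_limit_def using l(1) by (rule limI)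
  with l show "em_sum M c \<longlonglongrightarrow> em_limit M c"
    and "cmod (em_limit M c - em_sum M c n)
       \<le> em_const M * cmod (falling c (Suc M)) * (\<Sum>m. 1 / real (Suc m) ^ 2) * real n powr (Re c - real M + 1)"
    by (simp_all add: algebra_simps)
qed

text \<open>The explicit error in \<open>em_sum_converges\<close> is uniform on closed discs: the
  falling factorial is bounded by compactness, and the exponent of \<open>n\<close> is bounded by
  its value at the rightmost point. Locally uniform limits preserve holomorphy.\<close>

lemma em_limit_holomorphic: "em_limit M holomorphic_on ({c. Re c < real M - 1} - {-1})"
proof (rule holomorphic_uniform_sequence)
  show op: "open ({c. Re c < real M - 1} - {-1})"
    by (intro open_Diff open_halfspace_Re_lt) auto
  \<comment> \<open>The sequence starts at index 1 because \<open>em_sum_holomorphic\<close> asks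
    for a positive index.\<close>
  show "(\<lambda>c. em_sum M c (Suc n)) holomorphic_on ({c. Re c < real M - 1} - {-1})" for n
    by (rule holomorphic_on_subset[OF em_sum_holomorphic]) auto
  fix x assume x: "x \<in> {c. Re c < real M - 1} - {-1}"
  then obtain d where d: "d > 0" "cball x d \<subseteq> {c. Re c < real M - 1} - {-1}"
    using op open_contains_cball by blast
  have "compact ((\<lambda>c. falling c (Suc M)) ` cball x d)"
    by (intro compact_continuous_image holomorphic_on_imp_continuous_on holomorphic_intros) auto
  then obtain B where B: "\<And>c. c \<in> cball x d \<Longrightarrow> cmod (falling c (Suc M)) \<le> B"
    by (meson bounded_iff compact_imp_bounded imageI)
  have Re: "Re c - real M + 1 \<le> Re x + d - real M + 1" if "c \<in> cball x d" for c
    using that abs_Re_le_cmod[of "c - x"] by (auto simp: dist_norm norm_minus_commute)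
  \<comment> \<open>The rightmost point of the disc lies in the half-plane, so a single negative
    exponent serves the whole disc.\<close>
  have "x + of_real d \<in> cball x d" using d by (simp add: dist_norm)
  then have neg: "Re x + d - real M + 1 < 0" using d by auto
  define K where "K = em_const M * B * (\<Sum>m. 1 / real (Suc m) ^ 2)"
  have S0: "0 \<le> (\<Sum>m. 1 / real (Suc m) ^ 2)"
    by (intro suminf_nonneg summable_inverse_Suc_squares) auto
  have "uniform_limit (cball x d) (\<lambda>n c. em_sum M c (Suc n)) (em_limit M) sequentially"
  proof (rule uniform_limitI)
    fix e :: real assume "e > 0"
    have "(\<lambda>n. K * real (Suc n) powr (Re x + d - real M + 1)) \<longlonglongrightarrow> K * 0"
      using neg by (intro tendsto_intros tendsto_neg_powr filterlim_compose[OF filterlim_real_sequentially filterlim_Suc])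
    then have "eventually (\<lambda>n. K * real (Suc n) powr (Re x + d - real M + 1) < e) sequentially"
      using \<open>e > 0\<close> by (auto dest: order_tendstoD)
    then show "eventually (\<lambda>n. \<forall>c\<in>cball x d. dist (em_sum M c (Suc n)) (em_limit M c) < e) sequentially"
    proof eventually_elim
      case (elim n)
      show ?case
      proof
        fix c assume c: "c \<in> cball x d"
        have "dist (em_sum M c (Suc n)) (em_limit M c)
          \<le> em_const M * cmod (falling c (Suc M)) * (\<Sum>m. 1 / real (Suc m) ^ 2) * real (Suc n) powr (Re c - real M + 1)"
        proof -
          have "c \<in> {c. Re c < real M - 1} - {-1}" using c d(2) by blast
          then show ?thesis
            unfolding dist_norm norm_minus_commute[of "em_sum M c (Suc n)"]
            by (intro em_sum_converges(2)) auto
        qed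
        also have "\<dots> \<le> em_const M * B * (\<Sum>m. 1 / real (Suc m) ^ 2) * real (Suc n) powr (Re x + d - real M + 1)"
          using Re[OF c] B[OF c] order_trans[OF norm_ge_zero B[OF c]]
          by (intro mult_mono powr_mono S0)
             (auto simp: em_const_def simp del: of_nat_Suc intro!: sum_nonneg mult_nonneg_nonneg S0)
        also have "\<dots> < e" using elim by (simp add: K_def)
        finally show "dist (em_sum M c (Suc n)) (em_limit M c) < e" .
      qed
    qed
  qed
  with d show "\<exists>d>0. cball x d \<subseteq> {c. Re c < real M - 1} - {-1} \<and>
      uniform_limit (cball x d) (\<lambda>n c. em_sum M c (Suc n)) (em_limit M) sequentially"
    by blast
qed

lemma tendsto_of_nat_powr_0:
  assumes "Re c < 0"
  shows "(\<lambda>n. of_nat n powr c :: complex) \<longlonglongrightarrow> 0"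
proof (rule Lim_null_comparison)
  show "eventually (\<lambda>n. norm (of_nat n powr c :: complex) \<le> real n powr Re c) sequentially"
    using eventually_gt_at_top[of 0]
  proof eventually_elim
    case (elim n)
    then show ?case using norm_powr_real_powr[of "of_nat n" c] by simp
  qed
  show "(\<lambda>n. real n powr Re c) \<longlonglongrightarrow> 0"
    using assms by (intro tendsto_neg_powr filterlim_real_sequentially)
qed

text \<open>The additional correction is a multiple of \<open>n powr (c - M)\<close>, which tends to
  0. Hence the limits for different \<open>M\<close> agree on their common domain and can be
  glued.\<close>

lemma em_limit_Suc:
  assumes c: "c \<noteq> -1" "Re c < real M - 1"
  shows "em_limit (Suc M) c = em_limit M c"
proof -
  have "(\<lambda>n. em_sum M c n - of_real (em_coeff (Suc M)) * (falling c M * of_nat n powr (c - of_nat M)))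
     \<longlonglongrightarrow> em_limit M c - of_real (em_coeff (Suc M)) * (falling c M * 0)"
    using c by (intro tendsto_intros tendsto_of_nat_powr_0 em_sum_converges(1)[where n = 1]) auto
  also have "(\<lambda>n. em_sum M c n - of_real (em_coeff (Suc M)) * (falling c M * of_nat n powr (c - of_nat M)))
     = em_sum (Suc M) c"
    by (rule ext) (simp add: em_sum_def)
  finally have "em_sum (Suc M) c \<longlonglongrightarrow> em_limit M c" by simp
  then show ?thesis unfolding em_limit_def by (rule limI)
qed

lemma em_limit_le:
  assumes "M \<le> M'" "c \<noteq> -1" "Re c < real M - 1"
  shows "em_limit M' c = em_limit M c"
  using assms(1)
proof (induction rule: dec_induct)
  case (step n)
  then show ?case using em_limit_Suc[of c n] assms by simp
qed simp

text \<open>Already \<open>M = 0\<close> suffices here: the only subtracted term, a multiple of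
  \<open>n powr (c + 1)\<close>, tends to 0.\<close>

lemma em_limit_series:
  assumes "Re c < -1"
  shows "(\<lambda>k. of_nat (Suc k) powr c) sums em_limit M c"
proof -
  have c: "c \<noteq> -1" using assms by auto
  have "(\<lambda>n. em_sum 0 c n + of_nat n powr (c + 1) / (c + 1)) \<longlonglongrightarrow> em_limit 0 c + 0 / (c + 1)"
    using assms c by (intro tendsto_intros tendsto_of_nat_powr_0 em_sum_converges(1)[where n = 1]) (auto simp: add_eq_0_iff2)
  also have "(\<lambda>n. em_sum 0 c n + of_nat n powr (c + 1) / (c + 1)) = (\<lambda>n. \<Sum>k<n. of_nat (Suc k) powr c)"
    by (rule ext) (simp add: em_sum_def sum.shift_bounds_nat_ivl sum.atLeast1_atMost_eq)
  finally show ?thesis using em_limit_le[of 0 M c] assms c by (simp add: sums_def)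
qed

text \<open>The functions \<open>em_limit M\<close> are glued, with \<open>M\<close> growing with
  the modulus of \<open>Re s\<close>. That every admissible \<open>M\<close> gives the same value is
  used for holomorphy, where one \<open>M\<close> must serve a neighbourhood, and is exported for
  evaluating zeta.\<close>

lemma zeta_continuation_exists:
  "\<exists>f. f holomorphic_on (- {1}) \<and>
     (\<forall>s. Re s > 1 \<longrightarrow> (\<lambda>n. 1 / of_nat (Suc n) powr s) sums f s) \<and>
     (\<forall>M s. s \<noteq> 1 \<longrightarrow> Re s > 1 - real M \<longrightarrow> f s = em_limit M (- s))"
proof -
  define f where "f s = em_limit (nat \<lceil>\<bar>Re s\<bar>\<rceil> + 2) (- s)" for s
  have eq: "f s = em_limit M (- s)" if s: "s \<noteq> 1" "Re s > 1 - real M" for M s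
  proof -
    define L where "L = nat \<lceil>\<bar>Re s\<bar>\<rceil> + 2"
    have "Re (- s) < real L - 1"
      using abs_ge_minus_self[of "Re s"] unfolding L_def minus_complex.sel uminus_complex.sel by linarith
    moreover have "- s \<noteq> -1" using s by simp
    ultimately show ?thesis
      using s em_limit_le[of M L "-s"] em_limit_le[of L M "-s"]
      unfolding f_def L_def [symmetric] by (cases "M \<le> L") auto
  qed
  have "f holomorphic_on (- {1})"
  proof (rule holomorphic_on_open[THEN iffD2])
    show "\<forall>s\<in>- {1}. \<exists>f'. (f has_field_derivative f') (at s)"
    proof
      fix s :: complex assume s: "s \<in> - {1}"
      define M where "M = nat \<lceil>\<bar>Re s\<bar>\<rceil> + 2"
      define A where "A = {s. Re s > 1 - real M} - {1}"
      have "1 - real M < Re s"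
        using abs_ge_minus_self[of "Re s"] unfolding M_def by linarith
      then have sA: "s \<in> A" using s by (auto simp: A_def)
      have opA: "open A" unfolding A_def by (intro open_Diff open_halfspace_Re_gt) auto
      have "(em_limit M \<circ> uminus) holomorphic_on A"
        by (intro holomorphic_on_compose holomorphic_intros holomorphic_on_subset[OF em_limit_holomorphic])
           (auto simp: A_def)
      then have "f holomorphic_on A"
        by (rule holomorphic_transform) (auto simp: A_def eq)
      then show "\<exists>f'. (f has_field_derivative f') (at s)"
        using opA sA by (simp add: holomorphic_on_open)
    qed
  qed auto
  moreover have "(\<lambda>n. 1 / of_nat (Suc n) powr s) sums f s" if "Re s > 1" for s
  proof -
    have "(\<lambda>k. of_nat (Suc k) powr (-s)) sums f s"
      unfolding f_def using that by (intro em_limit_series) simp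
    also have "(\<lambda>k. of_nat (Suc k) powr (-s)) = (\<lambda>n. 1 / of_nat (Suc n) powr s)"
      by (simp add: powr_minus_divide)
    finally show ?thesis .
  qed
  ultimately show ?thesis using eq by blast
qed

text \<open>Existence makes \<open>SOME\<close> return a function with the defining properties. The
  identity theorem on the connected punctured plane, starting from the half-plane
  \<open>Re s > 1\<close>, identifies it with the glued function.\<close>

lemma riemann_zeta_eq_em_limit:
  assumes "c \<noteq> -1" "Re c < real M - 1"
  shows "riemann_zeta (- c) = em_limit M c"
proof -
  obtain f where f: "f holomorphic_on (- {1})"
     "\<And>s. Re s > 1 \<Longrightarrow> (\<lambda>n. 1 / of_nat (Suc n) powr s) sums f s"
     "\<And>M s. s \<noteq> 1 \<Longrightarrow> Re s > 1 - real M \<Longrightarrow> f s = em_limit M (- s)"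
    using zeta_continuation_exists by blast
  have z: "riemann_zeta holomorphic_on (- {1}) \<and>
     (\<forall>s. Re s > 1 \<longrightarrow> (\<lambda>n. 1 / of_nat (Suc n) powr s) sums riemann_zeta s)"
    unfolding riemann_zeta_def by (rule someI[of _ f]) (use f in auto)
  have "riemann_zeta (- c) = f (- c)"
  proof (rule analytic_continuation_open[where s = "{s. Re s > 1}" and s' = "- {1}" and f = riemann_zeta and g = f and z = "- c"])
    show "open {s. Re s > 1}" by (rule open_halfspace_Re_gt)
    show "{s. Re s > 1} \<noteq> {}" by (auto intro!: exI[of _ 2])
    show "connected (- {1 :: complex})"
      using connected_punctured_universe[of "1 :: complex"] by simp
    show "riemann_zeta s = f s" if s: "s \<in> {s. Re s > 1}" for s
      using s f(2)[of s] z by (auto intro: sums_unique2)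
    show "- c \<in> - {1}" using assms by (auto simp: minus_equation_iff)
  qed (use f z in auto)
  also have "f (- c) = em_limit M c"
    using assms f(3)[of "-c" M] by (auto simp: minus_equation_iff)
  finally show ?thesis .
qed

section \<open>Euler-Maclaurin summation with real exponents\<close>

definition zeta_neg :: "real \<Rightarrow> real" where
  "zeta_neg c = Re (riemann_zeta (of_real (- c)))"

lemma falling_of_real: "falling (of_real c) q = of_real (fact q * (c gchoose q))"
  by (simp add: falling_def gbinomial_mult_fact atLeast0LessThan)

lemma em_sum_of_real:
  assumes "n > 0"
  shows "em_sum M (of_real c) n = of_real ((\<Sum>k=1..n. real k powr c) - real n powr (c + 1) / (c + 1)
     - (\<Sum>i<M. em_coeff (Suc i) * (fact i * (c gchoose i)) * real n powr (c - real i)))"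
proof -
  have *: "(of_nat k :: complex) powr of_real x = of_real (real k powr x)" for k x
    using powr_of_real[of "real k" x] by simp
  have "power_deriv (of_real c) (Suc i) (of_nat n) = of_real (fact i * (c gchoose i) * real n powr (c - real i))" for i
    using *[of n "c - real i"] by (simp add: falling_of_real)
  moreover have "power_deriv (of_real c) 0 (of_nat n) = of_real (real n powr (c + 1) / (c + 1))"
    using *[of n "c + 1"] by simp
  ultimately show ?thesis
    by (simp add: em_sum_def * sum.lessThan_Suc_shift lessThan_Suc_atMost [symmetric] mult.assoc
         del: sum.lessThan_Suc power_deriv.simps)
qed

text \<open>For real \<open>c\<close> the zeta value is a limit of real numbers, so the real part in
  \<open>zeta_neg\<close> loses nothing. The asymptotics restate \<open>em_sum_converges\<close>,
  with falling factorials written as binomial coefficients in preparation for Vandermonde's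
  identity.\<close>

lemma
  assumes "c > -1"
  shows riemann_zeta_real: "riemann_zeta (of_real (- c)) = of_real (zeta_neg c)"
    and zeta_neg_asymptotic: "c < real M - 1 \<Longrightarrow> \<exists>C\<ge>0. \<forall>n\<ge>1. \<bar>(\<Sum>k=1..n. real k powr c) - zeta_neg c - real n powr (c + 1) / (c + 1)
     - (\<Sum>i<M. em_coeff (Suc i) * (fact i * (c gchoose i)) * real n powr (c - real i))\<bar> \<le> C * real n powr (c - real M + 1)"
proof -
  have ne: "complex_of_real c \<noteq> -1" using assms by (metis Re_complex_of_real less_irrefl uminus_complex.sel(1) one_complex.sel(1))
  have real: "riemann_zeta (of_real (- c)) \<in> \<real>" 
  proof -
    define M where "M = nat \<lceil>\<bar>c\<bar>\<rceil> + 2"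
    have M: "c < real M - 1" unfolding M_def by linarith
    have "em_limit M (of_real c) \<in> \<real>"
    proof (rule Lim_in_closed_set)
      show "em_sum M (of_real c) \<longlonglongrightarrow> em_limit M (of_real c)"
        using ne M by (intro em_sum_converges(1)[where n = 1]) auto
      show "eventually (\<lambda>n. em_sum M (of_real c) n \<in> \<real>) sequentially"
        using eventually_gt_at_top[of 0] by eventually_elim (simp only: em_sum_of_real Reals_of_real)
    qed (auto simp: closed_complex_Reals)
    then show ?thesis using riemann_zeta_eq_em_limit[of "of_real c" M] ne M by simp
  qed
  then show *: "riemann_zeta (of_real (- c)) = of_real (zeta_neg c)"
    by (simp add: zeta_neg_def)
  assume M: "c < real M - 1"
  define C where "C = em_const M * cmod (falling (of_real c) (Suc M)) * (\<Sum>m. 1 / real (Suc m) ^ 2)"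
  have "C \<ge> 0" unfolding C_def
    by (intro mult_nonneg_nonneg suminf_nonneg summable_inverse_Suc_squares) (auto simp: em_const_def sum_nonneg)
  moreover have "\<bar>(\<Sum>k=1..n. real k powr c) - zeta_neg c - real n powr (c + 1) / (c + 1)
     - (\<Sum>i<M. em_coeff (Suc i) * (fact i * (c gchoose i)) * real n powr (c - real i))\<bar> \<le> C * real n powr (c - real M + 1)"
    if n: "n \<ge> 1" for n
  proof -
    have "cmod (em_limit M (of_real c) - em_sum M (of_real c) n) \<le> C * real n powr (c - real M + 1)"
      using em_sum_converges(2)[of "of_real c" M n] ne M n by (simp add: C_def)
    also have "em_limit M (of_real c) = of_real (zeta_neg c)"
      using riemann_zeta_eq_em_limit[of "of_real c" M] ne M * by simp
    finally show ?thesis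
      using n by (simp add: em_sum_of_real of_real_diff [symmetric] norm_of_real abs_minus_commute algebra_simps del: of_real_diff of_real_add of_real_sum of_real_mult of_real_divide)
  qed
  ultimately show "\<exists>C\<ge>0. \<forall>n\<ge>1. \<bar>(\<Sum>k=1..n. real k powr c) - zeta_neg c - real n powr (c + 1) / (c + 1)
     - (\<Sum>i<M. em_coeff (Suc i) * (fact i * (c gchoose i)) * real n powr (c - real i))\<bar> \<le> C * real n powr (c - real M + 1)"
    by blast
qed

section \<open>Riesz sums of integral order\<close>

lemma binomial_sum_Suc:
  fixes f :: "nat \<Rightarrow> 'a :: comm_ring_1"
  shows "(\<Sum>j\<le>Suc r. of_nat (Suc r choose j) * f j) = (\<Sum>j\<le>r. of_nat (r choose j) * (f j + f (Suc j)))"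
proof -
  have "(\<Sum>j\<le>Suc r. of_nat (Suc r choose j) * f j)
      = f 0 + (\<Sum>j\<le>r. of_nat (r choose Suc j) * f (Suc j)) + (\<Sum>j\<le>r. of_nat (r choose j) * f (Suc j))"
    by (subst sum.atMost_Suc_shift) (simp add: algebra_simps sum.distrib)
  also have "f 0 + (\<Sum>j\<le>r. of_nat (r choose Suc j) * f (Suc j)) = (\<Sum>j\<le>Suc r. of_nat (r choose j) * f j)"
    by (subst sum.atMost_Suc_shift) simp
  also have "\<dots> = (\<Sum>j\<le>r. of_nat (r choose j) * f j)"
    by (simp add: binomial_eq_0)
  finally show ?thesis by (simp add: algebra_simps sum.distrib)
qed

text \<open>Expanding \<open>(1 - x) ^ r\<close> in the integral of
  \<open>x powr b * (1 - x) ^ r\<close> over the unit interval gives this sum. The induction avoids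
  the integral and uses \<open>Beta x y - Beta (x + 1) y = Beta x (y + 1)\<close> instead.\<close>

lemma alternating_binomial_Beta:
  assumes "b > (-1 :: real)"
  shows "(\<Sum>j\<le>r. real (r choose j) * ((-1) ^ j / (b + real j + 1))) = Beta (b + 1) (real r + 1)"
  using assms
proof (induction r arbitrary: b)
  case (0 b)
  have "b + 1 \<notin> \<int>\<^sub>\<le>\<^sub>0" using 0 by (auto elim!: nonpos_Ints_cases')
  have "Gamma ((b + 1) + 1) = (b + 1) * Gamma (b + 1)"
    using \<open>b + 1 \<notin> \<int>\<^sub>\<le>\<^sub>0\<close> by (rule Gamma_plus1[of "b + 1"])
  moreover have "Gamma (b + 1) > 0" using 0 by (simp add: Gamma_real_pos)
  ultimately have "Beta (b + 1) 1 = 1 / (b + 1)" by (simp add: Beta_def)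
  then show ?case by simp
next
  case (Suc r b)
  have "(\<Sum>j\<le>Suc r. real (Suc r choose j) * ((-1) ^ j / (b + real j + 1)))
      = (\<Sum>j\<le>r. real (r choose j) * ((-1) ^ j / (b + real j + 1)))
        - (\<Sum>j\<le>r. real (r choose j) * ((-1) ^ j / ((b + 1) + real j + 1)))"
    unfolding binomial_sum_Suc by (simp add: algebra_simps sum_subtractf)
  also have "\<dots> = Beta (b + 1) (real r + 1) - Beta ((b + 1) + 1) (real r + 1)"
    using Suc.IH[of b] Suc.IH[of "b + 1"] Suc.prems by simp
  also have "\<dots> = Beta (b + 1) (real (Suc r) + 1)"
  proof -
    have "b + 1 \<notin> \<int>\<^sub>\<le>\<^sub>0" "real r + 1 \<notin> \<int>\<^sub>\<le>\<^sub>0"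
      using Suc.prems by (auto elim!: nonpos_Ints_cases')
    from Beta_plus1_plus1[OF this] show ?thesis by (simp add: add_ac)
  qed
  finally show ?case .
qed

text \<open>Over the reals, both sides are \<open>x ^ l / fact l\<close> times the
  \<open>l\<close>-th derivative of \<open>(x + t) ^ r\<close> in \<open>x\<close>. The algebraic
  proof combines \<open>choose_mult\<close> with the binomial theorem.\<close>

lemma binomial_sum_choose:
  fixes x t :: "'a :: comm_ring_1"
  shows "(\<Sum>j\<le>r. of_nat (r choose j) * of_nat (j choose l) * x ^ j * t ^ (r - j))
       = of_nat (r choose l) * x ^ l * (x + t) ^ (r - l)"
proof (cases "l \<le> r")
  case True
  have "(\<Sum>j\<le>r. of_nat (r choose j) * of_nat (j choose l) * x ^ j * t ^ (r - j))
      = (\<Sum>j\<in>{l..r}. of_nat (r choose j) * of_nat (j choose l) * x ^ j * t ^ (r - j))"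
    by (rule sum.mono_neutral_right) (auto simp: binomial_eq_0)
  also have "\<dots> = (\<Sum>j\<in>{l..r}. of_nat (r choose l) * x ^ l * (of_nat ((r - l) choose (j - l)) * x ^ (j - l) * t ^ (r - j)))"
  proof (rule sum.cong)
    fix j assume j: "j \<in> {l..r}"
    then have "of_nat (r choose j) * of_nat (j choose l) = (of_nat ((r choose l) * ((r - l) choose (j - l))) :: 'a)"
      using choose_mult[of l j r] by (simp del: of_nat_mult add: of_nat_mult [symmetric])
    moreover have "x ^ j = x ^ l * x ^ (j - l)" using j by (simp add: power_add [symmetric])
    ultimately show "of_nat (r choose j) * of_nat (j choose l) * x ^ j * t ^ (r - j) =
       of_nat (r choose l) * x ^ l * (of_nat ((r - l) choose (j - l)) * x ^ (j - l) * t ^ (r - j))"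
      by (simp add: mult_ac)
  qed simp
  also have "\<dots> = of_nat (r choose l) * x ^ l * (\<Sum>j\<le>r - l. of_nat ((r - l) choose j) * x ^ j * t ^ (r - l - j))"
    unfolding sum_distrib_left
    by (rule sum.reindex_bij_witness[of _ "\<lambda>j. j + l" "\<lambda>j. j - l"]) (use True in auto)
  finally show ?thesis by (simp add: binomial_ring)
qed (auto simp: binomial_eq_0 intro!: sum.neutral)

text \<open>The sum is the \<open>i\<close>-th derivative of \<open>(t - x) ^ r * x powr b\<close> at \<open>x = n\<close>, divided by \<open>i!\<close>. The powers of \<open>t\<close>
  cancel down to powers of \<open>t - n\<close>, so the order of growth in \<open>n\<close> does not depend on \<open>r\<close>.\<close>

lemma endpoint_term_bound:
  fixes b t :: real
  assumes n: "n \<ge> 1" "real n \<le> t" "t \<le> real n + 1"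
  shows "\<bar>\<Sum>j\<le>r. real (r choose j) * (-1) ^ j * t ^ (r - j) * (((b + real j) gchoose i) * real n powr (b + real j - real i))\<bar>
     \<le> (\<Sum>l\<le>i. real (r choose l) * \<bar>b gchoose (i - l)\<bar>) * real n powr b"
proof -
  have "(\<Sum>j\<le>r. real (r choose j) * (-1) ^ j * t ^ (r - j) * (((b + real j) gchoose i) * real n powr (b + real j - real i)))
     = (\<Sum>j\<le>r. \<Sum>l\<le>i. real n powr (b - real i) * (b gchoose (i - l)) * (real (r choose j) * real (j choose l) * (- real n) ^ j * t ^ (r - j)))"
  proof (rule sum.cong)
    fix j
    \<comment> \<open>Vandermonde's identity plays the part of the Leibniz rule: it moves the
      dependence on \<open>j\<close> into \<open>j choose l\<close>, the form that
      \<open>binomial_sum_choose\<close> evaluates.\<close>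
    have "(b + real j) gchoose i = (\<Sum>l\<le>i. (real j gchoose l) * (b gchoose (i - l)))"
      using gbinomial_Vandermonde[of "real j" b i] by (simp add: add.commute atMost_atLeast0)
    moreover have "real n powr (b + real j - real i) = real n powr (b - real i) * real n ^ j"
      using n by (simp add: powr_add [symmetric] powr_realpow [symmetric] algebra_simps)
    moreover have "(- real n) ^ j = (-1) ^ j * real n ^ j" by (simp add: power_mult_distrib [symmetric])
    ultimately show "real (r choose j) * (-1) ^ j * t ^ (r - j) * (((b + real j) gchoose i) * real n powr (b + real j - real i))
      = (\<Sum>l\<le>i. real n powr (b - real i) * (b gchoose (i - l)) * (real (r choose j) * real (j choose l) * (- real n) ^ j * t ^ (r - j)))"
      by (simp add: sum_distrib_left sum_distrib_right binomial_gbinomial mult_ac)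
  qed simp
  also have "\<dots> = (\<Sum>l\<le>i. real n powr (b - real i) * (b gchoose (i - l)) * (real (r choose l) * (- real n) ^ l * (- real n + t) ^ (r - l)))"
    by (subst sum.swap) (simp add: sum_distrib_left [symmetric] binomial_sum_choose)
  also have "\<bar>\<dots>\<bar> \<le> (\<Sum>l\<le>i. real (r choose l) * \<bar>b gchoose (i - l)\<bar> * real n powr b)"
  proof (rule order_trans[OF sum_abs sum_mono])
    fix l assume l: "l \<in> {..i}"
    have "\<bar>- real n + t\<bar> ^ (r - l) \<le> 1" using n by (intro power_le_one) auto
    then have "\<bar>(- real n) ^ l * (- real n + t) ^ (r - l)\<bar> \<le> real n ^ l * 1"
      unfolding abs_mult power_abs by (intro mult_mono) auto
    then have "real n powr (b - real i) * \<bar>(- real n) ^ l * (- real n + t) ^ (r - l)\<bar> \<le> real n powr (b - real i) * real n ^ l"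
      by (intro mult_left_mono) auto
    also have "\<dots> = real n powr (b - real i + real l)"
      using n by (simp add: powr_add powr_realpow)
    also have "\<dots> \<le> real n powr b"
      using n l by (intro powr_mono) auto
    finally have "real (r choose l) * \<bar>b gchoose (i - l)\<bar> * (real n powr (b - real i) * \<bar>(- real n) ^ l * (- real n + t) ^ (r - l)\<bar>)
       \<le> real (r choose l) * \<bar>b gchoose (i - l)\<bar> * real n powr b"
      by (intro mult_left_mono) auto
    then show "\<bar>real n powr (b - real i) * (b gchoose (i - l)) * (real (r choose l) * (- real n) ^ l * (- real n + t) ^ (r - l))\<bar>
       \<le> real (r choose l) * \<bar>b gchoose (i - l)\<bar> * real n powr b"
      by (simp add: abs_mult mult_ac)
  qed
  finally show ?thesis by (simp add: sum_distrib_right)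
qed

text \<open>With a variable \<open>x\<close> in place of \<open>n\<close>, the sum is an
  antiderivative \<open>H\<close> of \<open>(t - x) ^ r * x powr b\<close>, and its value at
  \<open>t\<close> is the Beta term by \<open>alternating_binomial_Beta\<close>. The increment over
  an interval of length at most 1 is bounded by the integrand, where \<open>t - x\<close> lies
  between 0 and 1. The exponent is \<open>b + 1\<close> because \<open>x powr b\<close> decreases
  for negative \<open>b\<close>.\<close>

lemma antiderivative_increment_bound:
  fixes b t :: real
  assumes b: "b > -1" and n: "n \<ge> 1" "real n \<le> t" "t \<le> real n + 1"
  shows "\<bar>(\<Sum>j\<le>r. real (r choose j) * (-1) ^ j * t ^ (r - j) * (real n powr (b + real j + 1) / (b + real j + 1)))
     - Beta (b + 1) (real r + 1) * t powr (b + real r + 1)\<bar> \<le> t powr (b + 1)"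
proof -
  define H where "H x = (\<Sum>j\<le>r. real (r choose j) * (-1) ^ j * t ^ (r - j) * (x powr (b + real j + 1) / (b + real j + 1)))" for x
  have "H t = (\<Sum>j\<le>r. real (r choose j) * ((-1) ^ j / (b + real j + 1))) * t powr (b + real r + 1)"
    unfolding H_def sum_distrib_right
  proof (rule sum.cong)
    fix j assume j: "j \<in> {..r}"
    have "t ^ (r - j) * t powr (b + real j + 1) = t powr (b + real r + 1)"
      using n j by (simp add: powr_realpow [symmetric] powr_add [symmetric] of_nat_diff add_ac)
    then show "real (r choose j) * (-1) ^ j * t ^ (r - j) * (t powr (b + real j + 1) / (b + real j + 1))
      = real (r choose j) * ((-1) ^ j / (b + real j + 1)) * t powr (b + real r + 1)"
      by (simp add: mult_ac)
  qed simp
  also have "\<dots> = Beta (b + 1) (real r + 1) * t powr (b + real r + 1)"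
    using b by (simp only: alternating_binomial_Beta)
  finally have Ht: "H t = Beta (b + 1) (real r + 1) * t powr (b + real r + 1)" .
  have deriv: "(H has_field_derivative (t - x) ^ r * x powr b) (at x)" if x: "x > 0" for x
  proof -
    have "(H has_field_derivative (\<Sum>j\<le>r. real (r choose j) * (-1) ^ j * t ^ (r - j) * x powr (b + real j))) (at x)"
      unfolding H_def
    proof (rule DERIV_sum)
      fix j
      have "b + real j + 1 \<noteq> 0" using b by simp
      then show "((\<lambda>x. real (r choose j) * (-1) ^ j * t ^ (r - j) * (x powr (b + real j + 1) / (b + real j + 1)))
        has_field_derivative real (r choose j) * (-1) ^ j * t ^ (r - j) * x powr (b + real j)) (at x)"
        using x by (auto intro!: derivative_eq_intros)
    qed
    also have "(\<Sum>j\<le>r. real (r choose j) * (-1) ^ j * t ^ (r - j) * x powr (b + real j))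
       = (\<Sum>j\<le>r. real (r choose j) * (- x) ^ j * t ^ (r - j)) * x powr b"
      unfolding sum_distrib_right
      using x by (intro sum.cong) (simp_all add: powr_add powr_realpow power_minus[of x] mult_ac)
    also have "(\<Sum>j\<le>r. real (r choose j) * (- x) ^ j * t ^ (r - j)) = (t - x) ^ r"
      using binomial_ring[of "- x" t r] by simp
    finally show ?thesis .
  qed
  have "\<bar>H t - H (real n)\<bar> \<le> t powr (b + 1) * \<bar>t - real n\<bar>"
  proof (rule field_differentiable_bound[of "{real n..t}" H "\<lambda>x. (t - x) ^ r * x powr b", unfolded real_norm_def])
    fix x assume x: "x \<in> {real n..t}"
    then show "(H has_field_derivative (t - x) ^ r * x powr b) (at x within {real n..t})"
      using n by (intro has_field_derivative_at_within[OF deriv]) auto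
    have "(t - x) ^ r * x powr b \<le> 1 * x powr (b + 1)"
      using x n by (intro mult_mono power_le_one powr_mono) auto
    also have "x powr (b + 1) \<le> t powr (b + 1)"
      using x n b by (intro powr_mono2) auto
    finally show "\<bar>(t - x) ^ r * x powr b\<bar> \<le> t powr (b + 1)"
      using x by (simp add: abs_mult)
  qed (use n in auto)
  also have "\<dots> \<le> t powr (b + 1) * 1"
    using n by (intro mult_left_mono) auto
  finally have "\<bar>H (real n) - H t\<bar> \<le> t powr (b + 1)" by (simp add: abs_minus_commute)
  then show ?thesis unfolding Ht by (simp only: H_def)
qed

text \<open>For \<open>b > -1\<close> the Beta term is the integral of
  \<open>(t - x) ^ r * x powr b\<close> from 0 to \<open>t\<close>. The polynomial in
  \<open>t\<close> arises by expanding \<open>(t - k) ^ r\<close> and formally putting zeta at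
  \<open>- b - j\<close> for the sum of all \<open>k powr (b + j)\<close>.\<close>

definition riesz_error :: "real \<Rightarrow> nat \<Rightarrow> real \<Rightarrow> real" where
  "riesz_error b r t = (\<Sum>k=1..nat \<lfloor>t\<rfloor>. (t - real k) ^ r * real k powr b)
     - Beta (b + 1) (real r + 1) * t powr (b + real r + 1)
     - (\<Sum>j\<le>r. real (r choose j) * (-1) ^ j * t ^ (r - j) * zeta_neg (b + real j))"

text \<open>Once the zeta values are removed, three errors remain: the Euler-Maclaurin remainders,
  the increment of the antiderivative between \<open>n\<close> and \<open>t\<close>, and the
  endpoint terms. Each is bounded with an exponent independent of \<open>r\<close>, although the
  main term has exponent \<open>b + r + 1\<close>.\<close>

lemma riesz_error_bound:
  assumes b: "b > -1"
  shows "\<exists>C\<ge>0. \<forall>t\<ge>1. \<bar>riesz_error b r t\<bar> \<le> C * t powr (b + 1)"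
proof -
  \<comment> \<open>\<open>M\<close> has to exceed \<open>r\<close> because the remainders get
    multiplied by powers of \<open>t\<close> up to \<open>t ^ r\<close>; the part coming from
    \<open>b\<close> secures the hypothesis of \<open>zeta_neg_asymptotic\<close>.\<close>
  define M where "M = r + 2 + nat \<lceil>\<bar>b\<bar>\<rceil>"
  have M: "b + real j < real M - 1" if "j \<le> r" for j
    using that unfolding M_def by linarith
  have Mr: "real M \<ge> real r + 1" unfolding M_def by simp
  define d where "d i = em_coeff (Suc i) * fact i" for i
  define e where "e j n = (\<Sum>k=1..n. real k powr (b + real j)) - zeta_neg (b + real j)
      - real n powr (b + real j + 1) / (b + real j + 1)
      - (\<Sum>i<M. d i * (((b + real j) gchoose i) * real n powr (b + real j - real i)))" for j n
  have "\<forall>j. \<exists>C. j \<le> r \<longrightarrow> C \<ge> 0 \<and> (\<forall>n\<ge>1. \<bar>e j n\<bar> \<le> C * real n powr (b + real j - real M + 1))"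
  proof
    fix j
    show "\<exists>C. j \<le> r \<longrightarrow> C \<ge> 0 \<and> (\<forall>n\<ge>1. \<bar>e j n\<bar> \<le> C * real n powr (b + real j - real M + 1))"
      using zeta_neg_asymptotic[of "b + real j" M] M[of j] b unfolding e_def d_def
      by (cases "j \<le> r") (auto simp: mult.assoc)
  qed
  then obtain C where C: "\<And>j. j \<le> r \<Longrightarrow> C j \<ge> 0"
     "\<And>j n. j \<le> r \<Longrightarrow> n \<ge> 1 \<Longrightarrow> \<bar>e j n\<bar> \<le> C j * real n powr (b + real j - real M + 1)"
    by metis
  define K where "K i = (\<Sum>l\<le>i. real (r choose l) * \<bar>b gchoose (i - l)\<bar>)" for i
  define C1 where "C1 = (\<Sum>j\<le>r. real (r choose j) * 2 ^ r * C j)"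
  define C2 where "C2 = (\<Sum>i<M. \<bar>d i\<bar> * K i)"
  have C0: "C1 \<ge> 0" "C2 \<ge> 0"
    unfolding C1_def C2_def K_def by (auto intro!: sum_nonneg mult_nonneg_nonneg C)
  have "\<bar>riesz_error b r t\<bar> \<le> (C1 + 1 + C2) * t powr (b + 1)" if t: "t \<ge> 1" for t
  proof -
    define n where "n = nat \<lfloor>t\<rfloor>"
    have n: "n \<ge> 1" "real n \<le> t" "t \<le> real n + 1"
      using t unfolding n_def by linarith+
    define w where "w j = real (r choose j) * (-1) ^ j * t ^ (r - j)" for j
    have npow: "real n powr b \<le> t powr (b + 1)"
    proof -
      have "real n powr b \<le> real n powr (b + 1)" using n by (intro powr_mono) auto
      also have "\<dots> \<le> t powr (b + 1)" using n b by (intro powr_mono2) auto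
      finally show ?thesis .
    qed
    have "(\<Sum>k=1..n. (t - real k) ^ r * real k powr b) = (\<Sum>k=1..n. \<Sum>j\<le>r. w j * real k powr (b + real j))"
    proof (rule sum.cong)
      fix k assume k: "k \<in> {1..n}"
      have "(t - real k) ^ r = (\<Sum>j\<le>r. real (r choose j) * (- real k) ^ j * t ^ (r - j))"
        using binomial_ring[of "- real k" t r] by simp
      then have "(t - real k) ^ r * real k powr b = (\<Sum>j\<le>r. real (r choose j) * (- real k) ^ j * t ^ (r - j) * real k powr b)"
        by (simp only: sum_distrib_right)
      also have "\<dots> = (\<Sum>j\<le>r. w j * real k powr (b + real j))"
        using k by (intro sum.cong) (simp_all add: w_def powr_add powr_realpow power_minus[of "real k"] mult_ac)
      finally show "(t - real k) ^ r * real k powr b = (\<Sum>j\<le>r. w j * real k powr (b + real j))" .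
    qed simp
    also have "\<dots> = (\<Sum>j\<le>r. w j * (\<Sum>k=1..n. real k powr (b + real j)))"
      by (subst sum.swap) (simp add: sum_distrib_left)
    also have "\<dots> = (\<Sum>j\<le>r. w j * e j n + w j * zeta_neg (b + real j)
        + w j * (real n powr (b + real j + 1) / (b + real j + 1))
        + (\<Sum>i<M. d i * (w j * (((b + real j) gchoose i) * real n powr (b + real j - real i)))))"
      by (rule sum.cong) (simp_all add: e_def ring_distribs sum_distrib_left mult_ac)
    also have "\<dots> = (\<Sum>j\<le>r. w j * e j n) + (\<Sum>j\<le>r. w j * zeta_neg (b + real j))
        + (\<Sum>j\<le>r. w j * (real n powr (b + real j + 1) / (b + real j + 1)))
        + (\<Sum>i<M. d i * (\<Sum>j\<le>r. w j * (((b + real j) gchoose i) * real n powr (b + real j - real i))))"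
      by (simp add: sum.distrib sum_distrib_left sum.swap[of _ "{..<M}"])
    finally have split: "riesz_error b r t = (\<Sum>j\<le>r. w j * e j n)
        + ((\<Sum>j\<le>r. w j * (real n powr (b + real j + 1) / (b + real j + 1))) - Beta (b + 1) (real r + 1) * t powr (b + real r + 1))
        + (\<Sum>i<M. d i * (\<Sum>j\<le>r. w j * (((b + real j) gchoose i) * real n powr (b + real j - real i))))"
      by (simp add: riesz_error_def n_def [symmetric] w_def)
    have "\<bar>\<Sum>j\<le>r. w j * e j n\<bar> \<le> C1 * real n powr b"
      unfolding C1_def sum_distrib_right
    proof (rule order_trans[OF sum_abs sum_mono])
      fix j assume j: "j \<in> {..r}"
      \<comment> \<open>Here \<open>t\<close> is at most \<open>n + 1\<close>, hence at most
        \<open>2 * n\<close>.\<close>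
      have "t ^ (r - j) \<le> (2 * real n) ^ (r - j)" using n by (intro power_mono) auto
      also have "\<dots> \<le> 2 ^ r * real n ^ (r - j)"
        by (simp add: power_mult_distrib mult_right_mono power_increasing)
      finally have "t ^ (r - j) * \<bar>e j n\<bar> \<le> (2 ^ r * real n ^ (r - j)) * (C j * real n powr (b + real j - real M + 1))"
        using C j n by (intro mult_mono) auto
      also have "\<dots> = 2 ^ r * C j * real n powr (b + real r - real M + 1)"
        using n j by (simp add: powr_realpow [symmetric] powr_add [symmetric] of_nat_diff algebra_simps)
      also have "\<dots> \<le> 2 ^ r * C j * real n powr b"
        using n C j Mr by (intro mult_left_mono powr_mono) auto
      finally show "\<bar>w j * e j n\<bar> \<le> real (r choose j) * 2 ^ r * C j * real n powr b"
        using t by (simp add: w_def abs_mult power_abs mult_left_mono mult.assoc)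
    qed
    also have "\<dots> \<le> C1 * t powr (b + 1)"
      by (intro mult_left_mono npow C0)
    finally have 1: "\<bar>\<Sum>j\<le>r. w j * e j n\<bar> \<le> C1 * t powr (b + 1)" .
    have 2: "\<bar>(\<Sum>j\<le>r. w j * (real n powr (b + real j + 1) / (b + real j + 1))) - Beta (b + 1) (real r + 1) * t powr (b + real r + 1)\<bar> \<le> t powr (b + 1)"
      unfolding w_def by (rule antiderivative_increment_bound) (use b n in auto)
    have "\<bar>\<Sum>i<M. d i * (\<Sum>j\<le>r. w j * (((b + real j) gchoose i) * real n powr (b + real j - real i)))\<bar> \<le> C2 * real n powr b"
      unfolding C2_def sum_distrib_right
    proof (rule order_trans[OF sum_abs sum_mono])
      fix i
      show "\<bar>d i * (\<Sum>j\<le>r. w j * (((b + real j) gchoose i) * real n powr (b + real j - real i)))\<bar> \<le> \<bar>d i\<bar> * K i * real n powr b"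
        unfolding abs_mult K_def w_def mult.assoc[of "\<bar>d i\<bar>"]
        by (intro mult_left_mono endpoint_term_bound) (use n in auto)
    qed
    also have "\<dots> \<le> C2 * t powr (b + 1)"
      by (intro mult_left_mono npow C0)
    finally show ?thesis using 1 2 unfolding split by (simp add: ring_distribs)
  qed
  with C0 show ?thesis by (intro exI[of _ "C1 + 1 + C2"]) auto
qed

section \<open>Fractional integration\<close>

definition power_conv :: "real \<Rightarrow> real \<Rightarrow> nat \<Rightarrow> real" where
  "power_conv a b n = (\<Sum>k=1..n-1. real k powr b * real (n - k) powr a)"

text \<open>An affine substitution in the Beta integral. On the open interval both bases are
  positive, so \<open>powr\<close> with a natural exponent can later be replaced by
  \<open>^\<close>; at base 0 and exponent 0 the two differ.\<close>

lemma has_integral_Beta_interval: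
  fixes c d p q :: real
  assumes p: "p > 0" and q: "q > 0" and cd: "c < d"
  shows "((\<lambda>t. (t - c) powr (p - 1) * (d - t) powr (q - 1)) has_integral Beta p q * (d - c) powr (p + q - 1)) {c<..<d}"
proof -
  define L where "L = d - c"
  have L: "L > 0" using cd by (simp add: L_def)
  have "((\<lambda>x. ((1 / L) *\<^sub>R x + - c / L) powr (p - 1) * (1 - ((1 / L) *\<^sub>R x + - c / L)) powr (q - 1))
     has_integral Beta p q /\<^sub>R (1 / L) ^ DIM(real)) (cbox ((0 - - c / L) /\<^sub>R (1 / L)) ((1 - - c / L) /\<^sub>R (1 / L)))"
    by (rule has_integral_affinity') (use has_integral_Beta_real[OF p q] L in auto)
  also have "cbox ((0 - - c / L) /\<^sub>R (1 / L)) ((1 - - c / L) /\<^sub>R (1 / L)) = {c..d}"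
    using L by (simp add: L_def field_simps)
  finally have "((\<lambda>x. L powr (p + q - 2) * (((1 / L) *\<^sub>R x + - c / L) powr (p - 1) * (1 - ((1 / L) *\<^sub>R x + - c / L)) powr (q - 1)))
     has_integral L powr (p + q - 2) * (Beta p q * L)) {c<..<d}"
    by (intro has_integral_mult_right) (simp add: has_integral_Icc_iff_Ioo mult.commute)
  also have "L powr (p + q - 2) * (Beta p q * L) = Beta p q * (d - c) powr (p + q - 1)"
    using L powr_add[of L "p + q - 2" 1] by (simp add: L_def [symmetric])
  finally show ?thesis
  proof (rule has_integral_eq[rotated])
    fix x assume x: "x \<in> {c<..<d}"
    have "(1 / L) *\<^sub>R x + - c / L = (x - c) / L" by (simp add: diff_divide_distrib)
    moreover have "1 - (x - c) / L = (d - x) / L" using L by (simp add: L_def field_simps)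
    moreover have "L powr (p + q - 2) = L powr (p - 1) * L powr (q - 1)"
      by (simp add: powr_add [symmetric])
    ultimately show "L powr (p + q - 2) * (((1 / L) *\<^sub>R x + - c / L) powr (p - 1) * (1 - ((1 / L) *\<^sub>R x + - c / L)) powr (q - 1))
      = (x - c) powr (p - 1) * (d - x) powr (q - 1)"
      using x L by (simp add: powr_divide)
  qed
qed

text \<open>Integration against \<open>(n - t) powr (q - 1)\<close> is fractional integration of
  order \<open>q\<close> up to the factor \<open>1 / Gamma q\<close>. It sends the truncated power
  \<open>(t - k) ^ r\<close>, supported on \<open>t > k\<close>, to a multiple of
  \<open>(n - k) powr (q + r)\<close>, with the same Beta factor for every \<open>k\<close>.\<close>

lemma has_integral_riesz_sum:
  fixes q b :: real
  assumes q: "q > 0" and r: "r \<ge> 1"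
  shows "((\<lambda>t. (real n - t) powr (q - 1) * (\<Sum>k=1..nat \<lfloor>t\<rfloor>. (t - real k) ^ r * real k powr b))
     has_integral Beta (real r + 1) q * power_conv (q + real r) b n) {0<..<real n}"
proof -
  have "((\<lambda>t. \<Sum>k=1..n-1. real k powr b * (if t \<in> {real k<..<real n} then (t - real k) powr (real r + 1 - 1) * (real n - t) powr (q - 1) else 0))
     has_integral (\<Sum>k=1..n-1. real k powr b * (Beta (real r + 1) q * (real n - real k) powr (real r + 1 + q - 1)))) {0<..<real n}"
  proof (intro has_integral_sum has_integral_mult_right)
    fix k assume k: "k \<in> {1..n-1}"
    have "((\<lambda>t. (t - real k) powr (real r + 1 - 1) * (real n - t) powr (q - 1)) has_integral
        Beta (real r + 1) q * (real n - real k) powr (real r + 1 + q - 1)) {real k<..<real n}"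
      using k q by (intro has_integral_Beta_interval) auto
    moreover have "{real k<..<real n} \<subseteq> {0<..<real n}" by auto
    ultimately show "((\<lambda>t. if t \<in> {real k<..<real n} then (t - real k) powr (real r + 1 - 1) * (real n - t) powr (q - 1) else 0)
       has_integral Beta (real r + 1) q * (real n - real k) powr (real r + 1 + q - 1)) {0<..<real n}"
      by (simp only: has_integral_restrict)
  qed simp
  also have "(\<Sum>k=1..n-1. real k powr b * (Beta (real r + 1) q * (real n - real k) powr (real r + 1 + q - 1)))
     = Beta (real r + 1) q * power_conv (q + real r) b n"
    unfolding power_conv_def sum_distrib_left
    by (intro sum.cong) (auto simp: of_nat_diff add_ac)
  finally show ?thesis
  proof (rule has_integral_eq[rotated])
    fix t assume t: "t \<in> {0<..<real n}"
    have floor: "nat \<lfloor>t\<rfloor> \<le> n - 1" using t by (simp add: nat_le_iff floor_le_iff of_nat_diff) linarith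
    have "(\<Sum>k=1..nat \<lfloor>t\<rfloor>. (t - real k) ^ r * real k powr b)
      = (\<Sum>k=1..n-1. if t > real k then (t - real k) ^ r * real k powr b else 0)"
    proof -
      have "(\<Sum>k=1..nat \<lfloor>t\<rfloor>. (t - real k) ^ r * real k powr b)
        = (\<Sum>k=1..nat \<lfloor>t\<rfloor>. if t > real k then (t - real k) ^ r * real k powr b else 0)"
      proof (rule sum.cong)
        fix k assume "k \<in> {1..nat \<lfloor>t\<rfloor>}"
        then have "real k \<le> t" using t by (auto simp: le_nat_iff le_floor_iff)
        \<comment> \<open>The term with \<open>k = t\<close> vanishes because \<open>r\<close> is
          positive, so the closed range of the Riesz sum can be replaced by a strict
          inequality.\<close>
        then show "(t - real k) ^ r * real k powr b = (if t > real k then (t - real k) ^ r * real k powr b else 0)"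
          using r by (cases "t = real k") auto
      qed simp
      also have "\<dots> = (\<Sum>k=1..n-1. if t > real k then (t - real k) ^ r * real k powr b else 0)"
      proof (rule sum.mono_neutral_left)
        show "\<forall>k\<in>{1..n-1} - {1..nat \<lfloor>t\<rfloor>}. (if t > real k then (t - real k) ^ r * real k powr b else 0) = 0"
        proof
          fix k assume "k \<in> {1..n-1} - {1..nat \<lfloor>t\<rfloor>}"
          then have "nat \<lfloor>t\<rfloor> < k" by auto
          then have "t < real k" by linarith
          then show "(if t > real k then (t - real k) ^ r * real k powr b else 0) = 0" by simp
        qed
      qed (use floor in auto)
      finally show ?thesis .
    qed
    then show "(\<Sum>k=1..n-1. real k powr b * (if t \<in> {real k<..<real n} then (t - real k) powr (real r + 1 - 1) * (real n - t) powr (q - 1) else 0))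
      = (real n - t) powr (q - 1) * (\<Sum>k=1..nat \<lfloor>t\<rfloor>. (t - real k) ^ r * real k powr b)"
      using t by (auto simp: sum_distrib_left powr_realpow intro!: sum.cong)
  qed
qed

text \<open>The left side arises when the main term of the Riesz sum is integrated. Pulling out the
  Beta factor of \<open>has_integral_riesz_sum\<close> leaves the Gamma quotient of the expansion
  for \<open>a = q + r\<close>.\<close>

lemma Beta_mult_Beta:
  assumes "b > (-1 :: real)" "q > 0"
  shows "Beta (b + 1) (real r + 1) * Beta (b + real r + 2) q
       = Beta (real r + 1) q * (Gamma (q + real r + 1) * Gamma (b + 1) / Gamma (q + real r + b + 2))"
proof -
  have pos: "Gamma (b + real r + 2) > 0" "Gamma (q + real r + 1) > 0"
    using assms by (auto intro!: Gamma_real_pos)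
  have "Beta (b + 1) (real r + 1) = Gamma (b + 1) * Gamma (real r + 1) / Gamma (b + real r + 2)"
    by (simp add: Beta_def add_ac)
  moreover have "Beta (b + real r + 2) q = Gamma (b + real r + 2) * Gamma q / Gamma (q + real r + b + 2)"
    by (simp add: Beta_def add_ac)
  moreover have "Beta (real r + 1) q = Gamma (real r + 1) * Gamma q / Gamma (q + real r + 1)"
    by (simp add: Beta_def add_ac)
  ultimately show ?thesis using pos by simp
qed

text \<open>This is the source of the generalized binomial coefficients: integrating
  \<open>t ^ (r - j)\<close> turns \<open>r choose j\<close> into \<open>(q + r) gchoose j\<close>,
  up to the common Beta factor.\<close>

lemma binomial_mult_Beta:
  assumes "q > (0 :: real)" "j \<le> r"
  shows "real (r choose j) * Beta (real (r - j) + 1) q = Beta (real r + 1) q * ((q + real r) gchoose j)"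
proof -
  have pos: "Gamma (q + real r + 1) > 0" "Gamma (q + real r - real j + 1) > 0"
    using assms by (auto intro!: Gamma_real_pos)
  have "q + real r + 1 \<notin> \<int>\<^sub>\<le>\<^sub>0" using assms by (auto elim!: nonpos_Ints_cases')
  then have "(q + real r) gchoose j = Gamma (q + real r + 1) / (fact j * Gamma (q + real r - real j + 1))"
    by (rule gbinomial_Gamma)
  moreover have "Beta (real (r - j) + 1) q = fact (r - j) * Gamma q / Gamma (q + real r - real j + 1)"
    using Gamma_fact[of "r - j", where 'a = real] assms by (simp add: Beta_def of_nat_diff algebra_simps)
  moreover have "Beta (real r + 1) q = fact r * Gamma q / Gamma (q + real r + 1)"
    using Gamma_fact[of r, where 'a = real] by (simp add: Beta_def algebra_simps)
  moreover have "real (r choose j) = fact r / (fact j * fact (r - j))"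
    using assms by (simp add: binomial_fact)
  ultimately show ?thesis using pos by simp
qed

lemma has_integral_riesz_error:
  fixes q b :: real
  assumes q: "q > 0" and b: "b > -1" and r: "r \<ge> 1" and n: "n \<ge> 1"
  shows "((\<lambda>t. (real n - t) powr (q - 1) * riesz_error b r t) has_integral
     Beta (real r + 1) q * (power_conv (q + real r) b n
       - Gamma (q + real r + 1) * Gamma (b + 1) / Gamma (q + real r + b + 2) * real n powr (q + real r + b + 1)
       - (\<Sum>j\<le>r. (-1) ^ j * ((q + real r) gchoose j) * zeta_neg (b + real j) * real n powr (q + real r - real j)))) {0<..<real n}"
proof -
  have int: "((\<lambda>t. (t - 0) powr (p - 1) * (real n - t) powr (q - 1)) has_integral Beta p q * (real n - 0) powr (p + q - 1)) {0<..<real n}"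
    if "p > 0" for p
    using that q n by (intro has_integral_Beta_interval) auto
  have "((\<lambda>t. (real n - t) powr (q - 1) * (\<Sum>k=1..nat \<lfloor>t\<rfloor>. (t - real k) ^ r * real k powr b)
      - Beta (b + 1) (real r + 1) * ((t - 0) powr (b + real r + 2 - 1) * (real n - t) powr (q - 1))
      - (\<Sum>j\<le>r. (real (r choose j) * (-1) ^ j * zeta_neg (b + real j)) * ((t - 0) powr (real (r - j) + 1 - 1) * (real n - t) powr (q - 1))))
    has_integral Beta (real r + 1) q * power_conv (q + real r) b n
      - Beta (b + 1) (real r + 1) * (Beta (b + real r + 2) q * (real n - 0) powr (b + real r + 2 + q - 1))
      - (\<Sum>j\<le>r. (real (r choose j) * (-1) ^ j * zeta_neg (b + real j)) * (Beta (real (r - j) + 1) q * (real n - 0) powr (real (r - j) + 1 + q - 1)))) {0<..<real n}"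
    by (intro has_integral_diff has_integral_mult_right has_integral_sum has_integral_riesz_sum int q r) (use b in auto)
  also have "Beta (b + 1) (real r + 1) * (Beta (b + real r + 2) q * (real n - 0) powr (b + real r + 2 + q - 1))
     = Beta (real r + 1) q * (Gamma (q + real r + 1) * Gamma (b + 1) / Gamma (q + real r + b + 2) * real n powr (q + real r + b + 1))"
  proof -
    have "b + real r + 2 + q - 1 = q + real r + b + 1" by simp
    then show ?thesis using Beta_mult_Beta[OF b q, of r] by (simp only: mult.assoc [symmetric] diff_0_right)
  qed
  also have "(\<Sum>j\<le>r. (real (r choose j) * (-1) ^ j * zeta_neg (b + real j)) * (Beta (real (r - j) + 1) q * (real n - 0) powr (real (r - j) + 1 + q - 1)))
     = Beta (real r + 1) q * (\<Sum>j\<le>r. (-1) ^ j * ((q + real r) gchoose j) * zeta_neg (b + real j) * real n powr (q + real r - real j))"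
    unfolding sum_distrib_left
  proof (rule sum.cong)
    fix j assume j: "j \<in> {..r}"
    have pow: "(real n - 0) powr (real (r - j) + 1 + q - 1) = real n powr (q + real r - real j)"
      using j by (simp add: of_nat_diff algebra_simps)
    have regroup: "(real (r choose j) * (-1) ^ j * zeta_neg (b + real j)) * (Beta (real (r - j) + 1) q * x)
      = (-1) ^ j * zeta_neg (b + real j) * x * (real (r choose j) * Beta (real (r - j) + 1) q)" for x
      by (simp only: mult_ac)
    have "j \<le> r" using j by simp
    then show "(real (r choose j) * (-1) ^ j * zeta_neg (b + real j)) * (Beta (real (r - j) + 1) q * (real n - 0) powr (real (r - j) + 1 + q - 1))
      = Beta (real r + 1) q * ((-1) ^ j * ((q + real r) gchoose j) * zeta_neg (b + real j) * real n powr (q + real r - real j))"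
      unfolding pow regroup binomial_mult_Beta[OF q \<open>j \<le> r\<close>] by (simp only: mult_ac)
  qed simp
  finally show ?thesis
    unfolding right_diff_distrib
  proof (rule has_integral_eq[rotated])
    fix t assume t: "t \<in> {0<..<real n}"
    have p1: "t powr (b + real r + 2 - 1) = t powr (b + real r + 1)" by (simp add: algebra_simps)
    have p2: "t powr (real (r - j) + 1 - 1) = t ^ (r - j)" for j
      using t by (simp add: powr_realpow)
    show "(real n - t) powr (q - 1) * (\<Sum>k=1..nat \<lfloor>t\<rfloor>. (t - real k) ^ r * real k powr b)
      - Beta (b + 1) (real r + 1) * ((t - 0) powr (b + real r + 2 - 1) * (real n - t) powr (q - 1))
      - (\<Sum>j\<le>r. (real (r choose j) * (-1) ^ j * zeta_neg (b + real j)) * ((t - 0) powr (real (r - j) + 1 - 1) * (real n - t) powr (q - 1)))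
      = (real n - t) powr (q - 1) * riesz_error b r t"
      unfolding riesz_error_def diff_0_right p1 p2 by (simp add: sum_distrib_left right_diff_distrib mult_ac)
  qed
qed

section \<open>Asymptotic expansion\<close>

lemma powr_in_bigo:
  "e \<le> e' \<Longrightarrow> (\<lambda>n. c * real n powr e) \<in> O(\<lambda>n. real n powr e')"
  by (rule bigoI[of _ "\<bar>c\<bar>"])
     (auto simp: abs_mult intro!: eventually_mono[OF eventually_ge_at_top[of 1]] mult_left_mono powr_mono)

text \<open>For \<open>t < 1\<close> the Riesz sum is empty and the other terms are bounded, but
  they need not tend to 0 with \<open>t\<close>. Hence the bound uses the upper end \<open>n\<close>
  instead of \<open>t\<close>, which suffices for integration.\<close>

lemma riesz_error_bound_Ioc:
  assumes b: "b > -1"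
  shows "\<exists>C\<ge>0. \<forall>n::nat. \<forall>t. 0 < t \<longrightarrow> t \<le> real n \<longrightarrow> 1 \<le> n \<longrightarrow> \<bar>riesz_error b r t\<bar> \<le> C * real n powr (b + 1)"
proof -
  obtain C where C: "C \<ge> 0" "\<And>t. t \<ge> 1 \<Longrightarrow> \<bar>riesz_error b r t\<bar> \<le> C * t powr (b + 1)"
    using riesz_error_bound[OF b] by blast
  define D where "D = \<bar>Beta (b + 1) (real r + 1)\<bar> + (\<Sum>j\<le>r. real (r choose j) * \<bar>zeta_neg (b + real j)\<bar>)"
  have D: "D \<ge> 0" unfolding D_def by (auto intro!: sum_nonneg add_nonneg_nonneg)
  have small: "\<bar>riesz_error b r t\<bar> \<le> D" if t: "0 < t" "t < 1" for t
  proof -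
    have "nat \<lfloor>t\<rfloor> = 0" using t by linarith
    then have "\<bar>riesz_error b r t\<bar> \<le> \<bar>Beta (b + 1) (real r + 1) * t powr (b + real r + 1)\<bar>
       + \<bar>\<Sum>j\<le>r. real (r choose j) * (-1) ^ j * t ^ (r - j) * zeta_neg (b + real j)\<bar>"
      unfolding riesz_error_def by simp
    also have "\<bar>Beta (b + 1) (real r + 1) * t powr (b + real r + 1)\<bar> \<le> \<bar>Beta (b + 1) (real r + 1)\<bar> * 1"
      unfolding abs_mult using t b by (intro mult_left_mono) (auto intro!: powr_le1)
    also have "\<bar>\<Sum>j\<le>r. real (r choose j) * (-1) ^ j * t ^ (r - j) * zeta_neg (b + real j)\<bar>
        \<le> (\<Sum>j\<le>r. real (r choose j) * \<bar>zeta_neg (b + real j)\<bar>)"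
    proof (rule order_trans[OF sum_abs sum_mono])
      fix j
      have "t ^ (r - j) \<le> 1" using t by (intro power_le_one) auto
      then have "real (r choose j) * \<bar>zeta_neg (b + real j)\<bar> * t ^ (r - j) \<le> real (r choose j) * \<bar>zeta_neg (b + real j)\<bar> * 1"
        by (intro mult_left_mono) auto
      then show "\<bar>real (r choose j) * (-1) ^ j * t ^ (r - j) * zeta_neg (b + real j)\<bar> \<le> real (r choose j) * \<bar>zeta_neg (b + real j)\<bar>"
        using t by (simp add: abs_mult power_abs mult_ac)
    qed
    finally show ?thesis by (simp add: D_def)
  qed
  have "\<bar>riesz_error b r t\<bar> \<le> (C + D) * real n powr (b + 1)" if t: "0 < t" "t \<le> real n" and n: "1 \<le> n" for n t
  proof (cases "t < 1")
    case True
    have "D * 1 \<le> (C + D) * real n powr (b + 1)"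
      using n b C D by (intro mult_mono ge_one_powr_ge_zero) auto
    with small[of t] True t show ?thesis by simp
  next
    case False
    then have "\<bar>riesz_error b r t\<bar> \<le> C * t powr (b + 1)" by (intro C) auto
    also have "\<dots> \<le> (C + D) * real n powr (b + 1)"
      using t b C D by (intro mult_mono powr_mono2) auto
    finally show ?thesis .
  qed
  with C D show ?thesis by (intro exI[of _ "C + D"]) auto
qed

text \<open>For \<open>q \<ge> 1\<close> the kernel is at most \<open>n powr (q - 1)\<close>, so a
  constant bound of the integrand over an interval of length \<open>n\<close> yields the exponent
  \<open>(q - 1) + (b + 1) + 1\<close>. The recurrence later makes up for this crude error.\<close>

lemma power_conv_expansion_Riesz:
  assumes q: "q \<ge> 1" and b: "b > -1" and r: "r \<ge> 1"
  shows "(\<lambda>n. power_conv (q + real r) b n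
       - Gamma (q + real r + 1) * Gamma (b + 1) / Gamma (q + real r + b + 2) * real n powr (q + real r + b + 1)
       - (\<Sum>j\<le>r. (-1) ^ j * ((q + real r) gchoose j) * zeta_neg (b + real j) * real n powr (q + real r - real j)))
     \<in> O(\<lambda>n. real n powr (q + b + 1))" (is "?F \<in> _")
proof -
  obtain C where C: "C \<ge> 0"
      "\<And>n t. 0 < t \<Longrightarrow> t \<le> real n \<Longrightarrow> 1 \<le> n \<Longrightarrow> \<bar>riesz_error b r t\<bar> \<le> C * real n powr (b + 1)"
    using riesz_error_bound_Ioc[OF b, of r] by blast
  define B where "B = Beta (real r + 1) q"
  have B: "B > 0" unfolding B_def Beta_def using q by (auto intro!: divide_pos_pos mult_pos_pos Gamma_real_pos)
  have "norm (?F n) \<le> C / B * norm (real n powr (q + b + 1))" if n: "n \<ge> 1" for n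
  proof -
    define K where "K = real n powr (q - 1) * (C * real n powr (b + 1))"
    have I: "((\<lambda>t. (real n - t) powr (q - 1) * riesz_error b r t) has_integral B * ?F n) {0<..<real n}"
      unfolding B_def by (rule has_integral_riesz_error) (use q b r n in auto)
    have "((\<lambda>t. K) has_integral K * real n) {0..real n}"
      using has_integral_const_real[of K 0 "real n"] by (simp add: mult.commute)
    then have J: "((\<lambda>t. K) has_integral K * real n) {0<..<real n}"
      by (simp add: has_integral_Icc_iff_Ioo)
    have "norm (integral {0<..<real n} (\<lambda>t. (real n - t) powr (q - 1) * riesz_error b r t)) \<le> integral {0<..<real n} (\<lambda>t. K)"
    proof (rule integral_norm_bound_integral)
      fix t assume t: "t \<in> {0<..<real n}"
      have "\<bar>(real n - t) powr (q - 1)\<bar> * \<bar>riesz_error b r t\<bar> \<le> K"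
        unfolding K_def using t q n by (intro mult_mono C) (auto intro!: powr_mono2)
      then show "norm ((real n - t) powr (q - 1) * riesz_error b r t) \<le> K"
        by (simp add: abs_mult)
    qed (use I J in \<open>auto simp: integrable_on_def\<close>)
    then have "norm (B * ?F n) \<le> K * real n"
      using integral_unique[OF I] integral_unique[OF J] by simp
    also have "K * real n = C * real n powr (q + b + 1)"
    proof -
      have "real n powr (q + b + 1) = real n powr (q - 1) * real n powr (b + 1) * real n powr 1"
        by (simp only: powr_add [symmetric]) simp
      then show ?thesis using n by (simp add: K_def)
    qed
    finally have "norm (B * ?F n) \<le> C * real n powr (q + b + 1)" .
    moreover have "norm x \<le> C / B * norm y" if "norm (B * x) \<le> C * y" "y \<ge> 0" for x y :: real
      using that B by (simp add: abs_mult field_simps)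
    ultimately show ?thesis by simp
  qed
  then show ?thesis
    by (intro bigoI[of _ "C / B"] eventually_mono[OF eventually_ge_at_top[of 1]])
qed

lemma power_conv_expansion_large:
  assumes a: "a \<ge> 2" and b: "b > -1"
  shows "(\<lambda>n. power_conv a b n - Gamma (a + 1) * Gamma (b + 1) / Gamma (a + b + 2) * real n powr (a + b + 1)
       - (\<Sum>j<N. (-1) ^ j * (a gchoose j) * zeta_neg (b + real j) * real n powr (a - real j)))
     \<in> O(\<lambda>n. real n powr max (a - real N) (b + 3))"
proof -
  \<comment> \<open>This choice puts \<open>q\<close> between 1 and 2, so the error exponent
    \<open>q + b + 1\<close> stays below \<open>b + 3\<close> however large \<open>a\<close>
    is.\<close>
  define r where "r = nat \<lfloor>a\<rfloor> - 1"
  define q where "q = a - real r"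
  have r: "r \<ge> 1" "real r = of_int \<lfloor>a\<rfloor> - 1" using a unfolding r_def by linarith+
  then have q: "q \<ge> 1" "q < 2" unfolding q_def by linarith+
  have aq: "a = q + real r" by (simp add: q_def)
  define T where "T n j = (-1) ^ j * (a gchoose j) * zeta_neg (b + real j) * real n powr (a - real j)" for n j
  define G where "G n = power_conv a b n - Gamma (a + 1) * Gamma (b + 1) / Gamma (a + b + 2) * real n powr (a + b + 1)" for n
  let ?O = "O(\<lambda>n. real n powr max (a - real N) (b + 3))"
  have "(\<lambda>n. G n - (\<Sum>j\<le>r. T n j)) \<in> O(\<lambda>n. real n powr (q + b + 1))"
    using power_conv_expansion_Riesz[OF q(1) b r(1)] unfolding aq [symmetric] G_def T_def .
  also have "(\<lambda>n. real n powr (q + b + 1)) \<in> ?O"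
    using powr_in_bigo[of "q + b + 1" "max (a - real N) (b + 3)" 1] q by simp
  finally have 1: "(\<lambda>n. G n - (\<Sum>j\<le>r. T n j)) \<in> ?O" .
  have 2: "(\<lambda>n. \<Sum>j\<in>{..r} - {..<N}. T n j) \<in> ?O"
    unfolding T_def by (intro big_sum_in_bigo powr_in_bigo) auto
  \<comment> \<open>The terms missing from the Riesz expansion have \<open>j > r\<close>, hence
    exponent at most \<open>q - 1 < 1\<close>, which is below \<open>b + 3\<close>.\<close>
  have 3: "(\<lambda>n. \<Sum>j\<in>{..<N} - {..r}. T n j) \<in> ?O"
    unfolding T_def by (intro big_sum_in_bigo powr_in_bigo) (use aq q b in \<open>auto simp: not_le\<close>)
  have "(\<Sum>j<N. T n j) = (\<Sum>j\<le>r. T n j) - (\<Sum>j\<in>{..r} - {..<N}. T n j) + (\<Sum>j\<in>{..<N} - {..r}. T n j)" for n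
    using sum.Int_Diff[of "{..<N}" "T n" "{..r}"] sum.Int_Diff[of "{..r}" "T n" "{..<N}"]
    by (simp add: Int_commute)
  then have "(\<lambda>n. G n - (\<Sum>j<N. T n j)) = (\<lambda>n. (G n - (\<Sum>j\<le>r. T n j)) + (\<Sum>j\<in>{..r} - {..<N}. T n j) - (\<Sum>j\<in>{..<N} - {..r}. T n j))"
    by (simp add: fun_eq_iff)
  also have "\<dots> \<in> ?O" by (intro sum_in_bigo 1 2 3)
  finally show ?thesis unfolding G_def T_def .
qed

section \<open>The two-sided remainder and its recurrence\<close>

definition power_conv_remainder :: "real \<Rightarrow> real \<Rightarrow> nat \<Rightarrow> nat \<Rightarrow> nat \<Rightarrow> real" where
  "power_conv_remainder a b M N n =
     power_conv a b n - Gamma (a + 1) * Gamma (b + 1) / Gamma (a + b + 2) * real n powr (a + b + 1)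
     - (\<Sum>k<M. (-1) ^ k * (b gchoose k) * zeta_neg (a + real k) * real n powr (b - real k))
     - (\<Sum>k<N. (-1) ^ k * (a gchoose k) * zeta_neg (b + real k) * real n powr (a - real k))"

lemma power_conv_commute: "power_conv a b n = power_conv b a n"
  unfolding power_conv_def
  by (rule sum.reindex_bij_witness[of _ "\<lambda>k. n - k" "\<lambda>k. n - k"]) (auto simp: mult.commute)

lemma power_conv_remainder_commute:
  "power_conv_remainder a b M N = power_conv_remainder b a N M"
  unfolding power_conv_remainder_def by (subst power_conv_commute) (simp add: add_ac mult_ac fun_eq_iff)

text \<open>Multiplication by \<open>n\<close> raises each exponent by one. Pascal's rule writes
  \<open>a gchoose Suc k\<close> as \<open>(a + 1) gchoose Suc k\<close> minus
  \<open>a gchoose k\<close>; in the latter part the shift of \<open>k\<close> becomes the shift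
  from \<open>b\<close> to \<open>b + 1\<close> and costs one term. The identity is purely
  combinatorial, hence the arbitrary \<open>z\<close>.\<close>

lemma expansion_recurrence:
  assumes n: "n \<ge> 1"
  shows "real n * (\<Sum>k<N. (-1) ^ k * (a gchoose k) * z (b + real k) * real n powr (a - real k))
     = (\<Sum>k<N - 1. (-1) ^ k * (a gchoose k) * z (b + 1 + real k) * real n powr (a - real k))
     + (\<Sum>k<N. (-1) ^ k * ((a + 1) gchoose k) * z (b + real k) * real n powr (a + 1 - real k))"
proof (cases N)
  case (Suc m)
  have pow: "real n * real n powr x = real n powr (x + 1)" for x
    using n by (simp add: powr_add)
  have "real n * (\<Sum>k<Suc m. (-1) ^ k * (a gchoose k) * z (b + real k) * real n powr (a - real k))
     = (\<Sum>k<Suc m. (-1) ^ k * (a gchoose k) * z (b + real k) * real n powr (a + 1 - real k))"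
    unfolding sum_distrib_left
  proof (rule sum.cong)
    fix k
    show "real n * ((-1) ^ k * (a gchoose k) * z (b + real k) * real n powr (a - real k))
      = (-1) ^ k * (a gchoose k) * z (b + real k) * real n powr (a + 1 - real k)"
      using pow[of "a - real k"] by (simp add: algebra_simps)
  qed simp
  also have "\<dots> = z b * real n powr (a + 1) + (\<Sum>k<m. (-1) ^ Suc k * (a gchoose Suc k) * z (b + 1 + real k) * real n powr (a - real k))"
    by (subst sum.lessThan_Suc_shift) (simp add: algebra_simps)
  also have "(\<Sum>k<m. (-1) ^ Suc k * (a gchoose Suc k) * z (b + 1 + real k) * real n powr (a - real k))
     = (\<Sum>k<m. (-1) ^ k * (a gchoose k) * z (b + 1 + real k) * real n powr (a - real k))
       + (\<Sum>k<m. (-1) ^ Suc k * ((a + 1) gchoose Suc k) * z (b + 1 + real k) * real n powr (a - real k))"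
    unfolding sum.distrib [symmetric]
    unfolding gbinomial_Suc_Suc by (rule sum.cong) (simp_all add: algebra_simps)
  also have "z b * real n powr (a + 1) + \<dots>
     = (\<Sum>k<m. (-1) ^ k * (a gchoose k) * z (b + 1 + real k) * real n powr (a - real k))
       + (\<Sum>k<Suc m. (-1) ^ k * ((a + 1) gchoose k) * z (b + real k) * real n powr (a + 1 - real k))"
    by (subst sum.lessThan_Suc_shift) (simp add: algebra_simps)
  finally show ?thesis by (simp add: Suc)
qed simp

text \<open>This is \<open>Beta x y = Beta (x + 1) y + Beta x (y + 1)\<close> in the shape of the
  main term.\<close>

lemma Gamma_quotient_recurrence:
  assumes "a > (-1 :: real)" "b > -1"
  shows "Gamma (a + 1) * Gamma (b + 1) / Gamma (a + b + 2)
       = Gamma (a + 1) * Gamma (b + 2) / Gamma (a + b + 3) + Gamma (a + 2) * Gamma (b + 1) / Gamma (a + b + 3)"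
proof -
  have "a + 1 \<notin> \<int>\<^sub>\<le>\<^sub>0" "b + 1 \<notin> \<int>\<^sub>\<le>\<^sub>0"
    using assms by (auto elim!: nonpos_Ints_cases')
  from Beta_plus1_plus1[OF this] show ?thesis by (simp add: Beta_def add_ac)
qed

lemma power_conv_recurrence:
  "real n * power_conv a b n = power_conv a (b + 1) n + power_conv (a + 1) b n"
  unfolding power_conv_def sum_distrib_left sum.distrib [symmetric]
proof (rule sum.cong)
  fix k assume "k \<in> {1..n-1}"
  then have k: "k \<ge> 1" "k < n" by auto
  have "real k powr (b + 1) = real k * real k powr b" "real (n - k) powr (a + 1) = real (n - k) * real (n - k) powr a"
    using k by (simp_all add: powr_add)
  moreover have "real n = real k + real (n - k)" using k by simp
  ultimately show "real n * (real k powr b * real (n - k) powr a)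
     = real k powr (b + 1) * real (n - k) powr a + real k powr b * real (n - k) powr (a + 1)"
    by (simp only: algebra_simps)
qed simp

text \<open>\<open>M\<close> counts the terms from the end \<open>k = n\<close>, \<open>N\<close>
  those from the end \<open>k = 0\<close>. Raising \<open>b\<close> costs a term of the latter,
  raising \<open>a\<close> one of the former, so each remainder on the right may grow by one power
  more, and the factor \<open>n\<close> absorbs it.\<close>

lemma power_conv_remainder_recurrence:
  assumes ab: "a > -1" "b > -1" and n: "n \<ge> 1"
  shows "real n * power_conv_remainder a b M N n
       = power_conv_remainder a (b + 1) M (N - 1) n + power_conv_remainder (a + 1) b (M - 1) N n"
proof -
  have pow: "real n * real n powr (a + b + 1) = real n powr (a + b + 2)"
    using n by (simp add: powr_add power2_eq_square)
  have "real n * (Gamma (a + 1) * Gamma (b + 1) / Gamma (a + b + 2) * real n powr (a + b + 1))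
     = Gamma (a + 1) * Gamma (b + 2) / Gamma (a + b + 3) * real n powr (a + b + 2)
       + Gamma (a + 2) * Gamma (b + 1) / Gamma (a + b + 3) * real n powr (a + b + 2)"
    unfolding Gamma_quotient_recurrence[OF ab] pow [symmetric] by (simp add: algebra_simps)
  then show ?thesis
    using expansion_recurrence[OF n, where N = N and a = a and z = zeta_neg and b = b]
      expansion_recurrence[OF n, where N = M and a = b and z = zeta_neg and b = a]
      power_conv_recurrence[of n a b]
    unfolding power_conv_remainder_def right_diff_distrib
    by (simp add: add_ac)
qed

text \<open>The shift by 3 allows for a negative number of terms: below 3 the sums stay empty by truncated
  subtraction, while the error term keeps growing. The recurrence preserves \<open>a + p\<close> and \<open>b + q\<close>, so the
  exponent is large enough for \<open>power_conv_expansion_large\<close> once \<open>p\<close> or \<open>q\<close> has reached 0.\<close>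

lemma power_conv_remainder_bigo_shifted:
  assumes "a > -1" "b > -1" "a + real p > 2" "b + real q > 2"
  shows "power_conv_remainder a b (p - 3) (q - 3) \<in> O(\<lambda>n. real n powr max (b + 3 - real p) (a + 3 - real q))"
proof -
  \<comment> \<open>When \<open>p = 0\<close> the hypotheses give \<open>a > 2\<close>, and an error
    of size \<open>n powr (b + 3)\<close> is allowed. By symmetry the same fact serves
    \<open>q = 0\<close>.\<close>
  have base: "power_conv_remainder a b 0 (q - 3) \<in> O(\<lambda>n. real n powr max (b + 3) (a + 3 - real q))"
    if "a \<ge> 2" "b > -1" for a b q
  proof -
    have "power_conv_remainder a b 0 (q - 3) \<in> O(\<lambda>n. real n powr max (a - real (q - 3)) (b + 3))"
      using power_conv_expansion_large[OF that, of "q - 3"] unfolding power_conv_remainder_def by simp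
    also have "(\<lambda>n. real n powr max (a - real (q - 3)) (b + 3)) \<in> O(\<lambda>n. real n powr max (b + 3) (a + 3 - real q))"
      using powr_in_bigo[of "max (a - real (q - 3)) (b + 3)" "max (b + 3) (a + 3 - real q)" 1] by simp
    finally show ?thesis .
  qed
  show ?thesis using assms
  proof (induction p arbitrary: a b q)
    case 0
    then show ?case using base[of a b q] by simp
  next
    case (Suc p)
    \<comment> \<open>The recurrence lowers \<open>q\<close> in one summand and \<open>p\<close> in
      the other. The outer hypothesis, for all \<open>q\<close>, is saved here for the second; the
      inner induction supplies the first.\<close>
    note IHp = Suc.IH
    from Suc.prems show ?case
    proof (induction q arbitrary: a b)
      case 0
      then show ?case using base[of b a "Suc p"]
        by (subst power_conv_remainder_commute) (simp add: max.commute)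
    next
      case (Suc q)
      define e where "e = max (b + 3 - real (Suc p)) (a + 3 - real (Suc q))"
      have "power_conv_remainder a (b + 1) (Suc p - 3) (q - 3) \<in> O(\<lambda>n. real n powr max (b + 1 + 3 - real (Suc p)) (a + 3 - real q))"
        by (rule Suc.IH) (use Suc.prems in auto)
      also have "max (b + 1 + 3 - real (Suc p)) (a + 3 - real q) = e + 1"
        by (simp add: e_def max_def)
      finally have 1: "power_conv_remainder a (b + 1) (Suc p - 3) (q - 3) \<in> O(\<lambda>n. real n powr (e + 1))" .
      have "power_conv_remainder (a + 1) b (p - 3) (Suc q - 3) \<in> O(\<lambda>n. real n powr max (b + 3 - real p) (a + 1 + 3 - real (Suc q)))"
        by (rule IHp) (use Suc.prems in auto)
      also have "max (b + 3 - real p) (a + 1 + 3 - real (Suc q)) = e + 1"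
        by (simp add: e_def max_def)
      finally have 2: "power_conv_remainder (a + 1) b (p - 3) (Suc q - 3) \<in> O(\<lambda>n. real n powr (e + 1))" .
      have "(\<lambda>n. inverse (real n) * (power_conv_remainder a (b + 1) (Suc p - 3) (q - 3) n + power_conv_remainder (a + 1) b (p - 3) (Suc q - 3) n))
         \<in> O(\<lambda>n. inverse (real n) * real n powr (e + 1))"
        by (intro landau_o.big.mult sum_in_bigo 1 2) auto
      also have "(\<lambda>n. inverse (real n) * real n powr (e + 1)) = (\<lambda>n. real n powr e)"
      proof
        \<comment> \<open>At \<open>n = 0\<close> both sides are 0 by the conventions for
          \<open>inverse\<close> and \<open>powr\<close>.\<close>
        fix n show "inverse (real n) * real n powr (e + 1) = real n powr e"
          by (cases "n = 0") (auto simp: powr_add)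
      qed
      also have "(\<lambda>n. inverse (real n) * (power_conv_remainder a (b + 1) (Suc p - 3) (q - 3) n + power_conv_remainder (a + 1) b (p - 3) (Suc q - 3) n)) \<in> O(\<lambda>n. real n powr e)
        \<longleftrightarrow> power_conv_remainder a b (Suc p - 3) (Suc q - 3) \<in> O(\<lambda>n. real n powr e)"
      proof (rule landau_o.big.in_cong, rule eventually_mono[OF eventually_ge_at_top[of 1]])
        fix n :: nat assume n: "n \<ge> 1"
        \<comment> \<open>Truncation makes this hold for \<open>p < 3\<close> too: both sides are
          then 0, so the recurrence also runs through the shifted range.\<close>
        have eq: "Suc p - 3 - 1 = p - 3" "Suc q - 3 - 1 = q - 3" by auto
        have "real n * power_conv_remainder a b (Suc p - 3) (Suc q - 3) n
          = power_conv_remainder a (b + 1) (Suc p - 3) (q - 3) n + power_conv_remainder (a + 1) b (p - 3) (Suc q - 3) n"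
          using power_conv_remainder_recurrence[of a b n "Suc p - 3" "Suc q - 3"] Suc.prems n unfolding eq by simp
        then show "inverse (real n) * (power_conv_remainder a (b + 1) (Suc p - 3) (q - 3) n + power_conv_remainder (a + 1) b (p - 3) (Suc q - 3) n)
          = power_conv_remainder a b (Suc p - 3) (Suc q - 3) n"
          using n by (simp add: field_simps)
      qed
      finally show ?case by (simp only: e_def)
    qed
  qed
qed

lemma power_conv_remainder_bigo:
  assumes "a > -1" "b > -1" "M > 0" "N > 0"
  shows "power_conv_remainder a b M N \<in> O(\<lambda>n. real n powr max (b - real M) (a - real N))"
  using power_conv_remainder_bigo_shifted[of a b "M + 3" "N + 3"] assms by simp

theorem mainTheorem6:
  fixes \<alpha> \<beta> :: real and M N :: nat
  assumes "\<alpha> > -1" and "\<beta> > -1" and "M > 0" and "N > 0"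
  shows "(\<lambda>n::nat.
      complex_of_real (\<Sum>k=1..n-1. real k powr \<beta> * real (n - k) powr \<alpha>)
      - (complex_of_real (Gamma (\<alpha> + 1) * Gamma (\<beta> + 1) / Gamma (\<alpha> + \<beta> + 2)
           * real n powr (\<alpha> + \<beta> + 1))
         + (\<Sum>k<M. (-1) ^ k * complex_of_real (\<beta> gchoose k)
              * riemann_zeta (complex_of_real (- \<alpha> - real k))
              * complex_of_real (real n powr (\<beta> - real k)))
         + (\<Sum>k<N. (-1) ^ k * complex_of_real (\<alpha> gchoose k)
              * riemann_zeta (complex_of_real (- \<beta> - real k))
              * complex_of_real (real n powr (\<alpha> - real k)))))
    \<in> O(\<lambda>n. complex_of_real (real n powr max (\<beta> - real M) (\<alpha> - real N)))"
    (is "?f \<in> _")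
proof -
  \<comment> \<open>The argument is written in the form to which the simplifier brings
    \<open>complex_of_real (- x - real k)\<close>.\<close>
  have zeta: "riemann_zeta (- complex_of_real x - of_nat k) = complex_of_real (zeta_neg (x + real k))"
    if "x > -1" for x k
    using riemann_zeta_real[of "x + real k"] that by (simp add: algebra_simps)
  have "?f = (\<lambda>n. complex_of_real (power_conv_remainder \<alpha> \<beta> M N n))"
    by (rule ext) (simp add: power_conv_remainder_def power_conv_def zeta assms)
  also have "\<dots> \<in> O(\<lambda>n. complex_of_real (real n powr max (\<beta> - real M) (\<alpha> - real N)))"
    using power_conv_remainder_bigo[OF assms] unfolding bigo_def by simp
  finally show ?thesis .
qed

end
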